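(* Let $(H,U,J,\gamma_*,\beta,\zeta)$ be real parameter values with $W_J=0$, and let $(E,\kappa,\omega,\zeta)$ be the associated linear parameters $$E=\tfrac14\Big(H+\beta J+\tfrac{UJ}{2}\Big),\qquad \kappa=\tfrac J4,\qquad \omega=\beta U+\tfrac{U^2}{4}-\gamma_* .$$ Assume that $(E,\kappa,\omega,\zeta)\in\Omega$, that $F(x)$ is linearly independent from $1,x,\frac1x$, that the amplitude profile $A(y)$ is non-constant, that $\sigma\neq0$ and $D\neq0$, and that $T_*=4\pi W_H\neq0$. Then the equation for the characteristics of the Whitham modulation equations associated with $i\psi_t=\psi_{xx}+\zeta f(|\psi|^2)\psi$ is equivalent to the (leading-order) normal form for the continuous bands of spectrum emerging from the origin in the spectral plane. That is, with $A,a$ the coefficient matrices of the quasi-linear Whitham system (in case (i) $W_{HJ}\ne0$, or in case (ii) $W_{JJ}\neq0$ and $W_{HH}\ne0$; at least one of these cases holds because $\sigma\neq 0$), and under the change of variables $$\lambda=X'-UT',\qquad \mu=iT',$$ a pair $(X',T')\in\mathbb C^2$ satisfies $$\det(AX'-aT')=0$$ if and only if $$\det\left(\lambda^{2}\begin{pmatrix}a_2 & b_2 \\ b_2 & d_2\end{pmatrix}+\lambda\mu\begin{pmatrix}a_1 & b_1 \\ b_1 & d_1\end{pmatrix}+\mu^{2}\begin{pmatrix}a_0 & b_0 \\ b_0 & d_0\end{pmatrix}\right)=0 .$$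
   Context: **Equation and linear-theory quantities.** Consider $i\psi_t=\psi_{xx}+\zeta f(|\psi|^2)\psi$, with $f$ real-valued and well-behaved (regular enough that all parameter derivatives below exist and mixed partial derivatives are symmetric), and $F$ a fixed antiderivative of $f$ ($F'=f$). Travelling waves are reduced, using phase, translation and Galilean invariance, to $\psi=e^{i\omega t}e^{iS(y)}A(y)$ with $S_y=\kappa/A^2$ and $$A_y^2=2E-\omega A^2-\frac{\kappa^2}{A^2}-\zeta F(A^2).$$ $\Omega$ is the open set of $(E,\kappa,\omega,\zeta)$ such that $\kappa>0$ and the function $2E-\omega A^2-\kappa^2/A^2-\zeta F(A^2)$ has two positive real simple roots $a_-<a_+$ and is real and positive for $A\in(a_-,a_+)$. The profile $A(y)$ is the periodic solution with $A(0)=a_-$, $A(T_*/2)=a_+$. On $\Omega$ one can freely differentiate in the parameters. Put $$K(E,\kappa,\omega,\zeta)=2\int_{a_-}^{a_+}\sqrt{2E-\omega A^2-\tfrac{\kappa^2}{A^2}-\zeta F(A^2)}\,dA,$$ $T_*=K_E$ (period), $\eta=-K_\kappa$ (quasi-momentum), $M=-2K_\omega$ (mass). Subscripts $E,\kappa,\omega,\zeta$ on $K,T_*,\eta,M$ are partial derivatives in these independent variables (e.g. $T_{*\kappa}=\partial_\kappa T_*$). Write $\{P,Q\}_{x,y}=P_xQ_y-P_yQ_x$. Define $$\sigma=\{T_*,\eta\}_{E,\kappa},\quad \gamma=\{T_*,\eta\}_{\kappa,\omega},\quad \rho=\{T_*,\eta\}_{\omega,E},\quad \tau=\tfrac{T_*T_{*\kappa}}2,\quad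 \nu=-\tfrac{T_*T_{*E}}2,\quad \xi=\{T_*,\eta\}_{\kappa,\zeta},$$ $$D=\begin{vmatrix}K_{\kappa\kappa} & K_{\kappa E} & K_{\kappa\omega} & T_* \\ K_{\kappa E} & K_{EE} & K_{E\omega} & 0 \\ K_{\kappa\omega} & K_{E\omega} & K_{\omega\omega} & 0 \\ T_* & 0 & 0 & -M\end{vmatrix}.$$ The matrix entries of the normal form are $$a_2=-\tfrac\sigma2(\gamma M_E+\rho M_\kappa+\sigma M_\omega),\quad b_2=-\tfrac{\sigma\rho T_*}{2},\quad d_2=-\tfrac\sigma2\big(\nu T_*+\tfrac\sigma2M\big),$$ $$a_1=2i\sigma\rho T_*,\quad b_1=i\sigma T_*(\nu+\gamma),\quad d_1=i\sigma T_*(2\tau+\sigma\kappa),$$ $$a_0=2\sigma\nu T_*,\quad b_0=2\sigma\tau T_*,\quad d_0=2\sigma T_*(\omega\gamma-\zeta\xi-E\sigma).$$ (In the linear theory, $\lambda$ is the spectral parameter and $\mu$ the Floquet exponent, taken small; the full normal form is the displayed determinant plus $O(5)$, equal to zero, where $O(5)$ consists of terms $\lambda^i\mu^j$ with $i,j>0$ and $i+j\ge5$.) **Whitham equations.** The slowly varying parameters (functions of slow variables $X=\epsilon x$, $T=\epsilon t$) are $H,\omega_*,k,B,\gamma_*,\beta$, and one sets $U=\omega_*/k$, $J=B/k$. Define $$W(H,U,J,\gamma_*,\beta,\zeta)=\frac{\sqrt2}{\pi}\int_{R_-}^{R_+}\sqrt{H+\beta J+\tfrac{UJ}2-2R^2\big(\beta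 U+\tfrac{U^2}4-\gamma_*\big)-\tfrac{J^2}{8R^2}-2\zeta F(R^2)}\;dR,$$ where $R_\pm=a_\pm$ are the corresponding simple roots of the expression under the square root. One has $K=\pi W$ under $E=\frac14(H+\beta J+\frac{UJ}2)$, $\kappa=\frac J4$, $\omega=\beta U+\frac{U^2}4-\gamma_*$. Subscripts on $W$ denote partial derivatives with respect to the independent arguments $H,U,J,\gamma_*,\beta,\zeta$; $M_*:=W_{\gamma_*}$. The averaged Lagrangian is $\mathscr L=2kW-H$. The Whitham equations are $\partial_T\mathscr L_{\omega_*}-\partial_X\mathscr L_k=0$, $\partial_T\mathscr L_{\gamma_*}-\partial_X\mathscr L_\beta=0$, $\partial_Tk+\partial_X\omega_*=0$, $\partial_T\beta+\partial_X\gamma_*=0$ (derivatives of $\mathscr L$ taken with $H,\omega_*,k,B,\gamma_*,\beta$ independent), together with $\mathscr L_H=0$ and $\mathscr L_B=0$, i.e. $W_H=\frac1{2k}$ and $W_J=0$. Eliminating $k$ and using $W_J=0$, they become $$\beta_T+\gamma_{*X}=0,\qquad(1)$$ $$\partial_TW_H+U\partial_XW_H-W_HU_X=0,\qquad(2)$$ $$\partial_TW_U+U\partial_XW_U+W_UU_X-\partial_XW=0,\qquad(3)$$ $$W_H\partial_TM_*-M_*\partial_TW_H+UW_H\partial_XM_*-UM_*\partial_XW_H+W_HM_*U_X-W_H^2J_X=0.\qquad(4)$$ Since $\sigma=256\pi^2(W_{HJ}^2-W_{HH}W_{JJ})\ne0$, at least one of the following cases holds. The relation $W_J=0$ is solved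 by the implicit function theorem: (i) if $W_{HJ}\neq0$, as $H=g(U,J,\gamma_*,\beta)$; substituting this into (1)–(4), expanding all $X,T$-derivatives by the chain rule, and multiplying (2)–(4) by $W_{HJ}$ gives the quasi-linear system $A\,v_T+a\,v_X=0$ with $v=(J,\gamma_*,U,\beta)^{\top}$; (ii) if $W_{JJ}\neq0$ and $W_{HH}\ne 0$, as $J=h(H,U,\gamma_*,\beta)$; the same procedure, multiplying (2)–(4) by $W_{JJ}$, gives $A\,v_T+a\,v_X=0$ with $v=(H,\gamma_*,U,\beta)^{\top}$. In each case the rows of the $4\times4$ matrices $A,a$ correspond to (1),(2),(3),(4) in this order, and $A,a$ are evaluated at the given parameter point (where $W_J=0$). The equation for the characteristics is $\det(AX'-aT')=0$, where $X'=dX/ds$, $T'=dT/ds$ along a characteristic curve; complex values are allowed.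
   Formalization: The entry d_0 is taken as 2σT_*(ωγ+ζξ−Eσ), with plus sign on ζξ, instead of the printed 2σT_*(ωγ−ζξ−Eσ); with the printed sign the equivalence fails, e.g. for f(x)=x, E=1/2, κ=√2, ω=−2, ζ=2. *)

theory Defs
  imports "HOL-Analysis.Analysis"
begin

definition pd :: "'n \<Rightarrow> (real ^ 'n \<Rightarrow> real) \<Rightarrow> real ^ 'n \<Rightarrow> real" where
  "pd i G p = deriv (\<lambda>t. G (p + t *\<^sub>R axis i 1)) 0"

definition C1_on :: "(real ^ 'n) set \<Rightarrow> (real ^ 'n \<Rightarrow> real) \<Rightarrow> bool" where
  "C1_on N G \<longleftrightarrow> G differentiable_on N \<and> (\<forall>i. continuous_on N (pd i G))"

text \<open>Equality of mixed partials follows from the first two conjuncts on open sets; it is listed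
  because it belongs to the standing regularity assumption.\<close>

definition regular_on :: "(real ^ 'n) set \<Rightarrow> (real ^ 'n \<Rightarrow> real) \<Rightarrow> bool" where
  "regular_on N G \<longleftrightarrow> C1_on N G \<and> (\<forall>i. C1_on N (pd i G)) \<and>
     (\<forall>p\<in>N. \<forall>i j. pd i (pd j G) p = pd j (pd i G) p)"

definition lin_indep_from_1_x_inv :: "(real \<Rightarrow> real) \<Rightarrow> bool" where
  "lin_indep_from_1_x_inv F \<longleftrightarrow>
     (\<forall>c0 c1 c2 c3. (\<forall>x>0. c0 * F x + c1 + c2 * x + c3 / x = 0) \<longrightarrow>
        c0 = 0 \<and> c1 = 0 \<and> c2 = 0 \<and> c3 = 0)"


section \<open>Travelling waves and the linear theory\<close>

text \<open>A point of \<open>real ^ 4\<close> is \<open>(E, \<kappa>, \<omega>, \<zeta>)\<close>.\<close>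

abbreviation (input) iE :: 4 where "iE \<equiv> 1"
abbreviation (input) ik :: 4 where "ik \<equiv> 2"
abbreviation (input) iw :: 4 where "iw \<equiv> 3"
abbreviation (input) iz :: 4 where "iz \<equiv> 4"

definition radicand :: "(real \<Rightarrow> real) \<Rightarrow> real ^ 4 \<Rightarrow> real \<Rightarrow> real" where
  "radicand F p A =
     2 * p $ iE - p $ iw * A\<^sup>2 - (p $ ik)\<^sup>2 / A\<^sup>2 - p $ iz * F (A\<^sup>2)"

definition turning_points :: "(real \<Rightarrow> real) \<Rightarrow> real ^ 4 \<Rightarrow> real \<Rightarrow> real \<Rightarrow> bool" where
  "turning_points F p r s \<longleftrightarrow>
     0 < r \<and> r < s \<and>
     radicand F p r = 0 \<and> deriv (radicand F p) r \<noteq> 0 \<and>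
     radicand F p s = 0 \<and> deriv (radicand F p) s \<noteq> 0 \<and>
     (\<forall>A\<in>{r<..<s}. radicand F p A > 0)"

definition Omega :: "(real \<Rightarrow> real) \<Rightarrow> (real ^ 4) set" where
  "Omega F = {p. p $ ik > 0 \<and> (\<exists>r s. turning_points F p r s)}"

text \<open>For a general nonlinearity there may be several admissible pairs of roots at one parameter
  point, so the roots \<open>a\<^sub>-\<close>, \<open>a\<^sub>+\<close> are a continuous choice on an open part of \<open>Omega\<close>.\<close>

definition root_branch ::
  "(real \<Rightarrow> real) \<Rightarrow> (real ^ 4) set \<Rightarrow> (real ^ 4 \<Rightarrow> real) \<Rightarrow> (real ^ 4 \<Rightarrow> real) \<Rightarrow> bool" where
  "root_branch F N am ap \<longleftrightarrow>
     open N \<and> N \<subseteq> Omega F \<and> continuous_on N am \<and> continuous_on N ap \<and>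
     (\<forall>p\<in>N. turning_points F p (am p) (ap p))"

definition action ::
  "(real \<Rightarrow> real) \<Rightarrow> (real ^ 4 \<Rightarrow> real) \<Rightarrow> (real ^ 4 \<Rightarrow> real) \<Rightarrow> real ^ 4 \<Rightarrow> real" where
  "action F am ap p = 2 * integral {am p..ap p} (\<lambda>A. sqrt (radicand F p A))"

text \<open>In the following, \<open>K\<close> stands for the action.\<close>

definition Tstar :: "(real ^ 4 \<Rightarrow> real) \<Rightarrow> real ^ 4 \<Rightarrow> real" where
  "Tstar K p = pd iE K p"

definition eta :: "(real ^ 4 \<Rightarrow> real) \<Rightarrow> real ^ 4 \<Rightarrow> real" where
  "eta K p = - pd ik K p"

definition mass :: "(real ^ 4 \<Rightarrow> real) \<Rightarrow> real ^ 4 \<Rightarrow> real" where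
  "mass K p = - 2 * pd iw K p"

definition profile ::
  "(real \<Rightarrow> real) \<Rightarrow> (real ^ 4 \<Rightarrow> real) \<Rightarrow> (real ^ 4 \<Rightarrow> real) \<Rightarrow> real ^ 4 \<Rightarrow> (real \<Rightarrow> real) \<Rightarrow> bool" where
  "profile F am ap p A \<longleftrightarrow>
     (\<forall>y. A y > 0 \<and> A differentiable (at y) \<and> (deriv A y)\<^sup>2 = radicand F p (A y)) \<and>
     (\<forall>y. A (y + Tstar (action F am ap) p) = A y) \<and>
     A 0 = am p \<and> A (Tstar (action F am ap) p / 2) = ap p"

definition bracket ::
  "(real ^ 4 \<Rightarrow> real) \<Rightarrow> (real ^ 4 \<Rightarrow> real) \<Rightarrow> 4 \<Rightarrow> 4 \<Rightarrow> real ^ 4 \<Rightarrow> real" where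
  "bracket P Q x y p = pd x P p * pd y Q p - pd y P p * pd x Q p"

definition sigma :: "(real ^ 4 \<Rightarrow> real) \<Rightarrow> real ^ 4 \<Rightarrow> real" where
  "sigma K p = bracket (Tstar K) (eta K) iE ik p"

definition gamma_lin :: "(real ^ 4 \<Rightarrow> real) \<Rightarrow> real ^ 4 \<Rightarrow> real" where
  "gamma_lin K p = bracket (Tstar K) (eta K) ik iw p"

definition rho :: "(real ^ 4 \<Rightarrow> real) \<Rightarrow> real ^ 4 \<Rightarrow> real" where
  "rho K p = bracket (Tstar K) (eta K) iw iE p"

definition tau :: "(real ^ 4 \<Rightarrow> real) \<Rightarrow> real ^ 4 \<Rightarrow> real" where
  "tau K p = Tstar K p * pd ik (Tstar K) p / 2"

definition nu :: "(real ^ 4 \<Rightarrow> real) \<Rightarrow> real ^ 4 \<Rightarrow> real" where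
  "nu K p = - (Tstar K p * pd iE (Tstar K) p / 2)"

definition xi :: "(real ^ 4 \<Rightarrow> real) \<Rightarrow> real ^ 4 \<Rightarrow> real" where
  "xi K p = bracket (Tstar K) (eta K) ik iz p"

definition D_det :: "(real ^ 4 \<Rightarrow> real) \<Rightarrow> real ^ 4 \<Rightarrow> real" where
  "D_det K p =
     (let k = (\<lambda>i j. pd j (pd i K) p) in
      det (vector
        [vector [k ik ik, k ik iE, k ik iw, Tstar K p],
         vector [k ik iE, k iE iE, k iE iw, 0],
         vector [k ik iw, k iE iw, k iw iw, 0],
         vector [Tstar K p, 0, 0, - mass K p]] :: real ^ 4 ^ 4))"

definition normal2 :: "(real ^ 4 \<Rightarrow> real) \<Rightarrow> real ^ 4 \<Rightarrow> complex ^ 2 ^ 2" where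
  "normal2 K p =
     (let s = sigma K p; T = Tstar K p;
          a2 = - s / 2 * (gamma_lin K p * pd iE (mass K) p + rho K p * pd ik (mass K) p
                           + s * pd iw (mass K) p);
          b2 = - (s * rho K p * T / 2);
          d2 = - s / 2 * (nu K p * T + s / 2 * mass K p)
      in vector [vector [of_real a2, of_real b2], vector [of_real b2, of_real d2]])"

definition normal1 :: "(real ^ 4 \<Rightarrow> real) \<Rightarrow> real ^ 4 \<Rightarrow> complex ^ 2 ^ 2" where
  "normal1 K p =
     (let s = sigma K p; T = Tstar K p;
          a1 = 2 * \<i> * of_real (s * rho K p * T);
          b1 = \<i> * of_real (s * T * (nu K p + gamma_lin K p));
          d1 = \<i> * of_real (s * T * (2 * tau K p + s * p $ ik))
      in vector [vector [a1, b1], vector [b1, d1]])"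

text \<open>The term \<open>\<zeta> \<xi>\<close> in \<open>d0\<close> carries a plus sign, whereas the printed formula has
  \<open>\<omega> \<gamma> - \<zeta> \<xi> - E \<sigma>\<close>. With \<open>\<xi> = {T, \<eta>}\<close> in the order \<open>\<kappa>, \<zeta>\<close> the minus
  sign is a misprint: the action satisfies
  \<open>E K_E + \<kappa> K_\<kappa> / 2 + \<omega> K_\<omega> + \<zeta> K_\<zeta> = K / 2\<close>, hence
  \<open>\<omega> \<gamma> + \<zeta> \<xi> - E \<sigma> = T \<eta>_\<kappa> / 2\<close>, and it is this value for which the
  normal form is equivalent to the equation for the characteristics. With the minus sign the
  equivalence fails, for instance for \<open>f x = x\<close>, \<open>E = 1/2\<close>, \<open>\<kappa> = sqrt 2\<close>,
  \<open>\<omega> = - 2\<close>, \<open>\<zeta> = 2\<close>.\<close>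

definition normal0 :: "(real ^ 4 \<Rightarrow> real) \<Rightarrow> real ^ 4 \<Rightarrow> complex ^ 2 ^ 2" where
  "normal0 K p =
     (let s = sigma K p; T = Tstar K p;
          a0 = 2 * s * nu K p * T;
          b0 = 2 * s * tau K p * T;
          d0 = 2 * s * T * (p $ iw * gamma_lin K p + p $ iz * xi K p - p $ iE * s)
      in vector [vector [of_real a0, of_real b0], vector [of_real b0, of_real d0]])"

definition normal_form :: "(real ^ 4 \<Rightarrow> real) \<Rightarrow> real ^ 4 \<Rightarrow> complex \<Rightarrow> complex \<Rightarrow> complex" where
  "normal_form K p lam mu =
     det (\<chi> i j. lam\<^sup>2 * normal2 K p $ i $ j + lam * mu * normal1 K p $ i $ j
                + mu\<^sup>2 * normal0 K p $ i $ j)"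


section \<open>Whitham equations\<close>

text \<open>A point of \<open>real ^ 6\<close> is \<open>(H, U, J, \<gamma>\<^sub>*, \<beta>, \<zeta>)\<close>.\<close>

abbreviation (input) jH :: 6 where "jH \<equiv> 1"
abbreviation (input) jU :: 6 where "jU \<equiv> 2"
abbreviation (input) jJ :: 6 where "jJ \<equiv> 3"
abbreviation (input) jg :: 6 where "jg \<equiv> 4"
abbreviation (input) jb :: 6 where "jb \<equiv> 5"
abbreviation (input) jz :: 6 where "jz \<equiv> 6"

definition lin_params :: "real ^ 6 \<Rightarrow> real ^ 4" where
  "lin_params q = vector
     [(q $ jH + q $ jb * q $ jJ + q $ jU * q $ jJ / 2) / 4,
      q $ jJ / 4,
      q $ jb * q $ jU + (q $ jU)\<^sup>2 / 4 - q $ jg,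
      q $ jz]"

definition whitham_W ::
  "(real \<Rightarrow> real) \<Rightarrow> (real ^ 4 \<Rightarrow> real) \<Rightarrow> (real ^ 4 \<Rightarrow> real) \<Rightarrow> real ^ 6 \<Rightarrow> real" where
  "whitham_W F am ap q =
     sqrt 2 / pi * integral {am (lin_params q)..ap (lin_params q)}
       (\<lambda>R. sqrt (q $ jH + q $ jb * q $ jJ + q $ jU * q $ jJ / 2
                   - 2 * R\<^sup>2 * (q $ jb * q $ jU + (q $ jU)\<^sup>2 / 4 - q $ jg)
                   - (q $ jJ)\<^sup>2 / (8 * R\<^sup>2) - 2 * q $ jz * F (R\<^sup>2)))"

text \<open>The constraint surface \<open>W_J = 0\<close> is parametrised either by \<open>v = (J, \<gamma>\<^sub>*, U, \<beta>)\<close> with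
  \<open>H = g v\<close>, or by \<open>v = (H, \<gamma>\<^sub>*, U, \<beta>)\<close> with \<open>J = h v\<close>; \<open>\<zeta>\<close> is constant.\<close>

definition graph_H :: "real \<Rightarrow> (real ^ 4 \<Rightarrow> real) \<Rightarrow> real ^ 4 \<Rightarrow> real ^ 6" where
  "graph_H \<zeta> g v = vector [g v, v $ 3, v $ 1, v $ 2, v $ 4, \<zeta>]"

definition graph_J :: "real \<Rightarrow> (real ^ 4 \<Rightarrow> real) \<Rightarrow> real ^ 4 \<Rightarrow> real ^ 6" where
  "graph_J \<zeta> h v = vector [v $ 1, v $ 3, h v, v $ 2, v $ 4, \<zeta>]"

definition implicit_solution ::
  "(real ^ 6 \<Rightarrow> real) \<Rightarrow> ((real ^ 4 \<Rightarrow> real) \<Rightarrow> real ^ 4 \<Rightarrow> real ^ 6) \<Rightarrow>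
   real ^ 4 \<Rightarrow> real \<Rightarrow> (real ^ 4 \<Rightarrow> real) \<Rightarrow> bool" where
  "implicit_solution W graph v0 c g \<longleftrightarrow>
     g v0 = c \<and> (\<exists>V. open V \<and> v0 \<in> V \<and> C1_on V g \<and> (\<forall>v\<in>V. pd jJ W (graph g v) = 0))"

text \<open>For a quantity \<open>Q\<close> restricted to the surface parametrised by \<open>L\<close>, the chain rule gives
  \<open>Q_T = (\<Sum>j. pd j (Q \<circ> L) v * v_j,T)\<close>, and likewise for \<open>X\<close>. The rows below are the
  resulting coefficients of \<open>v_T\<close> and \<open>v_X\<close> in
  \<^item> \<open>\<beta>_T + \<gamma>\<^sub>*_X = 0\<close>
  \<^item> \<open>(W_H)_T + U (W_H)_X - W_H U_X = 0\<close>
  \<^item> \<open>(W_U)_T + U (W_U)_X + W_U U_X - W_X = 0\<close>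
  \<^item> \<open>W_H M_T - M (W_H)_T + U W_H M_X - U M (W_H)_X + W_H M U_X - W_H^2 J_X = 0\<close>,
    where \<open>M = W_\<gamma>\<^sub>*\<close>,

  the last three multiplied by \<open>m\<close>.\<close>

definition restr_pd :: "(real ^ 4 \<Rightarrow> real ^ 6) \<Rightarrow> real ^ 4 \<Rightarrow> (real ^ 6 \<Rightarrow> real) \<Rightarrow> 4 \<Rightarrow> real" where
  "restr_pd L v Q j = pd j (Q \<circ> L) v"

definition whitham_A ::
  "(real ^ 6 \<Rightarrow> real) \<Rightarrow> (real ^ 4 \<Rightarrow> real ^ 6) \<Rightarrow> real \<Rightarrow> real ^ 4 \<Rightarrow> real ^ 4 ^ 4" where
  "whitham_A W L m v =
     (let d = restr_pd L v; WH = pd jH W; WU = pd jU W; M = pd jg W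
      in vector
        [\<chi> j. d (\<lambda>q. q $ jb) j,
         \<chi> j. m * d WH j,
         \<chi> j. m * d WU j,
         \<chi> j. m * (WH (L v) * d M j - M (L v) * d WH j)])"

definition whitham_a ::
  "(real ^ 6 \<Rightarrow> real) \<Rightarrow> (real ^ 4 \<Rightarrow> real ^ 6) \<Rightarrow> real \<Rightarrow> real ^ 4 \<Rightarrow> real ^ 4 ^ 4" where
  "whitham_a W L m v =
     (let d = restr_pd L v; WH = pd jH W; WU = pd jU W; M = pd jg W;
          U = L v $ jU; dU = d (\<lambda>q. q $ jU); dJ = d (\<lambda>q. q $ jJ)
      in vector
        [\<chi> j. d (\<lambda>q. q $ jg) j,
         \<chi> j. m * (U * d WH j - WH (L v) * dU j),
         \<chi> j. m * (U * d WU j + WU (L v) * dU j - d W j),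
         \<chi> j. m * (U * WH (L v) * d M j - U * M (L v) * d WH j
                    + WH (L v) * M (L v) * dU j - (WH (L v))\<^sup>2 * dJ j)])"

definition char_det :: "real ^ 4 ^ 4 \<Rightarrow> real ^ 4 ^ 4 \<Rightarrow> complex \<Rightarrow> complex \<Rightarrow> complex" where
  "char_det A a X' T' =
     det (\<chi> i j. of_real (A $ i $ j) * X' - of_real (a $ i $ j) * T')"

end

theory Submission
  imports Defs
begin

text \<open>The expression under the root in \<open>W\<close> is twice the radicand, so \<open>\<pi> W\<close> is exactly \<open>K \<circ> lin_params\<close> and all derivatives of
  \<open>W\<close> are expressed by those of \<open>K\<close>. A pair \<open>(X', T')\<close> is characteristic iff some nonzero complex
  tangent vector of the surface \<open>W\<^sub>J = 0\<close> satisfies the four linearised Whitham equations. In either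
  parametrisation these tangent vectors are the variations of \<open>(H, U, J, \<gamma>\<^sub>*, \<beta>)\<close> with \<open>dW\<^sub>J = 0\<close>,
  so both cases lead to the same \<open>5 \<times> 5\<close> system. Passing to the variations of \<open>(E, \<kappa>, \<omega>, U)\<close> and
  eliminating that of \<open>\<beta>\<close> by the first equation leaves a \<open>4 \<times> 4\<close> determinant in \<open>\<lambda> = X' - U T'\<close>
  and \<open>T'\<close>, and \<open>\<sigma>\<^sup>3\<close> times this determinant is the normal form. The entry \<open>d0\<close> matches because the
  action is homogeneous: scaling \<open>(E, \<kappa>\<^sup>2, \<omega>, \<zeta>)\<close> scales the radicand and leaves its roots fixed.\<close>

section \<open>Vectors, determinants and the normal form polynomial\<close>

lemma vector_4 [simp]:
  "(vector [a, b, c, d] :: 'a::zero ^ 4) $ 1 = a"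
  "(vector [a, b, c, d] :: 'a ^ 4) $ 2 = b"
  "(vector [a, b, c, d] :: 'a ^ 4) $ 3 = c"
  "(vector [a, b, c, d] :: 'a ^ 4) $ 4 = d"
  unfolding vector_def by simp_all

lemma vector_6 [simp]:
  "(vector [a, b, c, d, e, f] :: 'a::zero ^ 6) $ 1 = a"
  "(vector [a, b, c, d, e, f] :: 'a ^ 6) $ 2 = b"
  "(vector [a, b, c, d, e, f] :: 'a ^ 6) $ 3 = c"
  "(vector [a, b, c, d, e, f] :: 'a ^ 6) $ 4 = d"
  "(vector [a, b, c, d, e, f] :: 'a ^ 6) $ 5 = e"
  "(vector [a, b, c, d, e, f] :: 'a ^ 6) $ 6 = f"
  unfolding vector_def by simp_all

lemma exhaust_6:
  fixes x :: 6
  shows "x = 1 \<or> x = 2 \<or> x = 3 \<or> x = 4 \<or> x = 5 \<or> x = 6"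
proof (induct x)
  case (of_int z)
  then have "z = 0 \<or> z = 1 \<or> z = 2 \<or> z = 3 \<or> z = 4 \<or> z = 5" by fastforce
  then show ?case by auto
qed

lemma forall_6: "(\<forall>i::6. P i) \<longleftrightarrow> P 1 \<and> P 2 \<and> P 3 \<and> P 4 \<and> P 5 \<and> P 6"
  by (metis exhaust_6)

lemma UNIV_6: "UNIV = {1, 2, 3, 4, 5, 6::6}"
  using exhaust_6 by auto

lemma sum_6: "sum f (UNIV::6 set) = f 1 + f 2 + f 3 + f 4 + f 5 + f 6"
  unfolding UNIV_6 by (simp add: ac_simps)

text \<open>Expansion along the first row, obtained by splitting off the images of 1, 2, 3 from the
  permutations in turn. The explicit polynomial lets \<open>algebra\<close> decide determinant
  identities.\<close>

lemma det_4:
  "det (A::'a::comm_ring_1^4^4) =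
     A$1$1 * (A$2$2 * (A$3$3 * A$4$4 - A$3$4 * A$4$3) - A$2$3 * (A$3$2 * A$4$4 - A$3$4 * A$4$2)
        + A$2$4 * (A$3$2 * A$4$3 - A$3$3 * A$4$2))
   - A$1$2 * (A$2$1 * (A$3$3 * A$4$4 - A$3$4 * A$4$3) - A$2$3 * (A$3$1 * A$4$4 - A$3$4 * A$4$1)
        + A$2$4 * (A$3$1 * A$4$3 - A$3$3 * A$4$1))
   + A$1$3 * (A$2$1 * (A$3$2 * A$4$4 - A$3$4 * A$4$2) - A$2$2 * (A$3$1 * A$4$4 - A$3$4 * A$4$1)
        + A$2$4 * (A$3$1 * A$4$2 - A$3$2 * A$4$1))
   - A$1$4 * (A$2$1 * (A$3$2 * A$4$3 - A$3$3 * A$4$2) - A$2$2 * (A$3$1 * A$4$3 - A$3$3 * A$4$1)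
        + A$2$3 * (A$3$1 * A$4$2 - A$3$2 * A$4$1))"
proof -
  have f1: "finite {2::4, 3, 4}" "1 \<notin> {2::4, 3, 4}" by auto
  have f2: "finite {3::4, 4}" "2 \<notin> {3::4, 4}" by auto
  have f3: "finite {4::4}" "3 \<notin> {4::4}" by auto
  show ?thesis
    unfolding det_def UNIV_4
    unfolding sum_over_permutations_insert[OF f1]
    unfolding sum_over_permutations_insert[OF f2]
    unfolding sum_over_permutations_insert[OF f3]
    unfolding permutes_sing
    by (simp add: sign_swap_id permutation_swap_id permutation_compose sign_compose sign_id
        swap_id_eq algebra_simps)
qed

text \<open>Systems in different unknowns, even of different size, are compared through their
  nonzero solutions; this is the passage to and from determinants.\<close>

lemma det_eq_0_iff_kernel:
  fixes A :: "'a::field ^ 'n ^ 'n"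
  shows "det A = 0 \<longleftrightarrow> (\<exists>x. x \<noteq> 0 \<and> A *v x = 0)"
  using invertible_det_nz[of A] invertible_left_inverse[of A] matrix_left_invertible_ker[of A] by blast

text \<open>\<open>a, b, c, d, e, f\<close> stand for the second derivatives of \<open>K\<close> in the directions
  \<open>EE, E\<kappa>, \<kappa>\<kappa>, E\<omega>, \<kappa>\<omega>, \<omega>\<omega>\<close>, and \<open>T\<^sub>* = 2 h\<close>, \<open>K\<^sub>\<omega> = 2 w\<close>; the \<open>2 \<times> 2\<close> determinant on the left is
  the normal form without its common factor \<open>\<sigma>\<^sup>2\<close> and with \<open>\<mu> = \<i> t\<close>.\<close>

lemma normal_form_identity:
  fixes a b c d e f h w k l t :: "'a::idom"
  defines "s \<equiv> b * b - a * c" and "g \<equiv> d * c - b * e" and "r \<equiv> a * e - d * b"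
  shows
   "(l\<^sup>2 * (g * d + r * e + s * f) - l * t * (4 * r * h) + t\<^sup>2 * (4 * h * h * a))
    * (l\<^sup>2 * (h * h * a + s * w) - l * t * (2 * h * (2 * h * b + s * k)) + t\<^sup>2 * (4 * h * h * c))
    - (l\<^sup>2 * (r * h) + l * t * (2 * h * (g - h * a)) + t\<^sup>2 * (4 * h * h * b))\<^sup>2
   = s * det (vector [vector [l * a, l * b, l * d, t * (2 * h)],
                          vector [- (l * d), t * (2 * h) - l * e, - (l * f), 0],
                          vector [t * (2 * h), l * h, 0, l * w - t * k * (2 * h)],
                          vector [l * b, l * c, l * e - t * (2 * h), l * h]] :: 'a ^ 4 ^ 4)"
  unfolding det_4 s_def g_def r_def vector_4
  by algebra

section \<open>Reduction of the characteristic system\<close>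

text \<open>\<open>(h, u, j, g, b)\<close> is a variation of \<open>(H, U, J, \<gamma>\<^sub>*, \<beta>)\<close>, \<open>(e, k, w)\<close> the induced variation of
  \<open>(E, \<kappa>, \<omega>)\<close>, \<open>P\<close> is \<open>\<pi>\<close>, and \<open>dKk\<close>, \<open>dKw\<close> are the variations of \<open>K\<^sub>\<kappa>\<close>, \<open>K\<^sub>\<omega>\<close>.
  The relation for \<open>dWJ\<close> is
  multiplied by \<open>l\<close> because \<open>r1\<close> determines only \<open>l * b\<close>; this is what eliminates \<open>b\<close>.\<close>

lemma characteristic_rows_reduce:
  fixes P :: "'a::field_char_0"
  assumes W: "4 * P * WH = T" "P * M = - Kw" "P * WU = T * \<kappa> / 2 + Kw * (\<beta> + U / 2)"
      "P * Wb = T * \<kappa> + Kw * U" "dW = WH * h + WU * u + M * g + Wb * b"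
    and lin: "4 * e = h + \<beta> * j + 4 * \<kappa> * b + U * j / 2 + 2 * \<kappa> * u" "j = 4 * k"
      "w = \<beta> * u + U * b + U * u / 2 - g"
    and dW: "4 * P * dWH = dT" "P * dM = - dKw"
      "P * dWU = (dT * \<kappa> + T * k) / 2 + dKw * (\<beta> + U / 2) + Kw * (b + u / 2)"
      "4 * P * dWJ = dT * (\<beta> + U / 2) + T * (b + u / 2) + dKk"
    and r1: "r1 = X * b - t * g"
    and r2: "r2 = X * dWH - t * (U * dWH - WH * u)"
    and r3: "r3 = X * dWU - t * (U * dWU + WU * u - dW)"
    and r4: "r4 = X * (WH * dM - M * dWH)
       - t * (U * WH * dM - U * M * dWH + WH * M * u - WH\<^sup>2 * j)"
    and X: "X = l + U * t"
  shows "r1 = l * b - t * ((\<beta> + U / 2) * u - w)"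
    and "l * dT + t * T * u = 4 * P * r2"
    and "WH * (t * T * k - l * dKw) = P * (r4 + M * r2)"
    and "l * T * k / 2 + l * Kw * u / 2 + t * T * e - t * \<kappa> * T * u
        = P * r3 + P * M * r1 + (\<beta> + U / 2) * (t * T * k - l * dKw) - 2 * \<kappa> * P * r2"
    and "l * dKk + l * T * u / 2 - t * T * w = 4 * P * l * dWJ - (\<beta> + U / 2) * (4 * P * r2) - T * r1"
proof -
  \<comment> \<open>The names for \<open>\<beta> + U / 2\<close>, \<open>T / 2\<close> and
    \<open>u / 2\<close> turn the hypotheses into polynomial relations without fractions, on which
    \<open>algebra\<close> can operate.\<close>
  define c where "c = \<beta> + U / 2"
  define hT where "hT = T / 2"
  define hu where "hu = u / 2"
  have T: "T = 2 * hT" and u: "u = 2 * hu" and U: "U = 2 * c - 2 * \<beta>" and h: "U * j / 2 = (c - \<beta>) * j"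
    and h': "U * u / 2 = U * hu"
    by (simp_all add: c_def hT_def hu_def field_simps)
  have h_eq: "h = 4 * e - \<beta> * j - 4 * \<kappa> * b - (c - \<beta>) * j - 4 * \<kappa> * hu"
    using lin(1) h u by (simp add: algebra_simps)
  have g_eq: "g = \<beta> * u + U * b + U * hu - w"
    using lin(3) h' by (simp add: algebra_simps)
  have dWU': "2 * P * dWU = (dT * \<kappa> + T * k) + 2 * dKw * c + 2 * Kw * (b + hu)"
    using dW(3) by (simp add: c_def hu_def field_simps)
  have dWJ': "4 * P * dWJ = dT * c + T * (b + hu) + dKk"
    using dW(4) by (simp add: c_def hu_def)
  show 1: "r1 = l * b - t * ((\<beta> + U / 2) * u - w)"
    unfolding c_def[symmetric] r1 X g_eq using u U by algebra
  show 2: "l * dT + t * T * u = 4 * P * r2"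
    using r2 X dW(1) W(1) by algebra
  \<comment> \<open>Adding \<open>M * r2\<close> removes \<open>dWH\<close> and \<open>u\<close>
    from \<open>r4\<close> and leaves the common factor \<open>WH\<close>.\<close>
  show 3: "WH * (t * T * k - l * dKw) = P * (r4 + M * r2)"
    using r4 r2 X W(1) dW(2) lin(2) by algebra
  have "2 * (l * hT * k + l * Kw * hu + t * T * e - t * \<kappa> * T * u)
        = 2 * (P * r3 + P * M * r1 + c * (t * T * k - l * dKw) - 2 * \<kappa> * P * r2)"
  proof -
    \<comment> \<open>The term \<open>WU * u\<close> of \<open>dW\<close> cancels in
      \<open>r3\<close>; adding \<open>M * r1\<close> then cancels \<open>M * g\<close>, so that the
      variation of \<gamma> disappears. Everything is doubled to keep the relation for
      \<open>dWU\<close> free of fractions.\<close>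
    have "r3 = l * dWU + t * (WH * h + M * g + Wb * b)"
      using r3 X W(5) by algebra
    moreover have "r1 = l * b + U * t * b - t * g"
      using r1 X by algebra
    ultimately have "2 * (P * r3 + P * M * r1)
       = l * (2 * P * dWU) + 2 * t * (P * WH * h + P * Wb * b) + 2 * (P * M) * (l * b + U * t * b)"
      by algebra
    also have "4 * P * r2 = l * dT + t * T * u" using 2 by simp
    moreover have "2 * P * WH = hT" using W(1) T
      by (simp add: field_simps)
    ultimately show ?thesis
      using W(2,4) dWU' h_eq lin(2) T u by algebra
  qed
  then have "l * hT * k + l * Kw * hu + t * T * e - t * \<kappa> * T * u
        = P * r3 + P * M * r1 + c * (t * T * k - l * dKw) - 2 * \<kappa> * P * r2"
    by (subst (asm) mult_cancel_left) simp
  then show "l * T * k / 2 + l * Kw * u / 2 + t * T * e - t * \<kappa> * T * u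
        = P * r3 + P * M * r1 + (\<beta> + U / 2) * (t * T * k - l * dKw) - 2 * \<kappa> * P * r2"
    by (simp add: hT_def hu_def c_def)
  have "l * dKk + l * T * hu - t * T * w = 4 * P * l * dWJ - c * (4 * P * r2) - T * r1"
    using 1 2 dWJ' u unfolding c_def[symmetric] by algebra
  then show "l * dKk + l * T * u / 2 - t * T * w
     = 4 * P * l * dWJ - (\<beta> + U / 2) * (4 * P * r2) - T * r1"
    by (simp add: hu_def c_def)
qed


text \<open>The vector \<open>y\<close> is a complex variation of (H, U, J, \<gamma>, \<beta>,
  \<zeta>), and \<open>z y\<close> collects the induced variations of (E, \<kappa>, \<omega>, U). By
  the row reduction, \<open>z\<close> sends solutions of the linearised system to kernel vectors of
  the \<open>4 \<times> 4\<close> matrix. Since \<open>z\<close> forgets the variation of \<beta>,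
  the converse must recover it, from \<open>r1\<close> if \<open>l\<close> is nonzero and from the
  constraint otherwise.\<close>

lemma characteristic_kernel:
  fixes P T Kw \<kappa> \<beta> U X t l :: "'a::field_char_0"
    and ee kk ww dWH dWU dM dWJ dW :: "'a ^ 6 \<Rightarrow> 'a"
  assumes nz: "P \<noteq> 0" "T \<noteq> 0" "X = l + U * t"
    and ee: "\<And>y. ee y = (y$1 + \<beta> * y$3 + 4 * \<kappa> * y$5 + U * y$3 / 2 + 2 * \<kappa> * y$2) / 4"
    and kk: "\<And>y. kk y = y$3 / 4"
    and ww: "\<And>y. ww y = \<beta> * y$2 + U * y$5 + U * y$2 / 2 - y$4"
    and dT: "\<And>y. dT y = a * ee y + b * kk y + d * ww y"
    and dKk: "\<And>y. dKk y = b * ee y + c * kk y + e * ww y"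
    and dKw: "\<And>y. dKw y = d * ee y + e * kk y + f * ww y"
    and W: "4 * P * WH = T" "P * M = - Kw" "P * WU = T * \<kappa> / 2 + Kw * (\<beta> + U / 2)"
      "P * Wb = T * \<kappa> + Kw * U"
    and dW: "\<And>y. y$6 = 0 \<Longrightarrow> dW y = WH * y$1 + WU * y$2 + M * y$4 + Wb * y$5"
    and dWH: "\<And>y. y$6 = 0 \<Longrightarrow> 4 * P * dWH y = dT y"
    and dM: "\<And>y. y$6 = 0 \<Longrightarrow> P * dM y = - dKw y"
    and dWU: "\<And>y. y$6 = 0 \<Longrightarrow> P * dWU y = (dT y * \<kappa> + T * kk y) / 2 + dKw y * (\<beta> + U / 2)
      + Kw * (y$5 + y$2 / 2)"
    and dWJ: "\<And>y. y$6 = 0 \<Longrightarrow> 4 * P * dWJ y = dT y * (\<beta> + U / 2) + T * (y$5 + y$2 / 2) + dKk y"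
  shows "(\<exists>y. y \<noteq> 0 \<and> y$6 = 0 \<and> dWJ y = 0 \<and> X * y$5 - t * y$4 = 0
            \<and> X * dWH y - t * (U * dWH y - WH * y$2) = 0
            \<and> X * dWU y - t * (U * dWU y + WU * y$2 - dW y) = 0
            \<and> X * (WH * dM y - M * dWH y)
                - t * (U * WH * dM y - U * M * dWH y + WH * M * y$2 - WH\<^sup>2 * y$3) = 0)
     \<longleftrightarrow> det (vector [vector [l * a, l * b, l * d, t * T],
                   vector [- (l * d), t * T - l * e, - (l * f), 0],
                   vector [t * T, l * (T / 2), 0, l * (Kw / 2) - t * \<kappa> * T],
                   vector [l * b, l * c, l * e - t * T, l * (T / 2)]] :: 'a ^ 4 ^ 4) = 0"
    (is "?lhs \<longleftrightarrow> det ?A = 0")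
proof -
  define r1 where "r1 y = X * y$5 - t * y$4" for y :: "'a ^ 6"
  define r2 where "r2 y = X * dWH y - t * (U * dWH y - WH * y$2)" for y
  define r3 where "r3 y = X * dWU y - t * (U * dWU y + WU * y$2 - dW y)" for y
  define r4 where "r4 y = X * (WH * dM y - M * dWH y)
                - t * (U * WH * dM y - U * M * dWH y + WH * M * y$2 - WH\<^sup>2 * y$3)" for y
  define z where "z y = (vector [ee y, kk y, ww y, y$2] :: 'a ^ 4)" for y
  have WH: "WH \<noteq> 0" using nz W(1) by auto
  have ker: "?A *v z y = 0 \<longleftrightarrow> l * dT y + t * T * y$2 = 0 \<and> t * T * kk y - l * dKw y = 0
      \<and> l * T * kk y / 2 + l * Kw * y$2 / 2 + t * T * ee y - t * \<kappa> * T * y$2 = 0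
      \<and> l * dKk y + l * T * y$2 / 2 - t * T * ww y = 0" for y
    unfolding vec_eq_iff forall_4 matrix_vector_mult_def z_def dT dKk dKw
    by (simp add: sum_4 algebra_simps)
  have red: "r1 y = l * y$5 - t * ((\<beta> + U / 2) * y$2 - ww y)"
    "l * dT y + t * T * y$2 = 4 * P * r2 y"
    "WH * (t * T * kk y - l * dKw y) = P * (r4 y + M * r2 y)"
    "l * T * kk y / 2 + l * Kw * y$2 / 2 + t * T * ee y - t * \<kappa> * T * y$2
        = P * r3 y + P * M * r1 y + (\<beta> + U / 2) * (t * T * kk y - l * dKw y) - 2 * \<kappa> * P * r2 y"
    "l * dKk y + l * T * y$2 / 2 - t * T * ww y
       = 4 * P * l * dWJ y - (\<beta> + U / 2) * (4 * P * r2 y) - T * r1 y" if "y$6 = 0" for y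
  proof -
    have e: "4 * ee y = y$1 + \<beta> * y$3 + 4 * \<kappa> * y$5 + U * y$3 / 2 + 2 * \<kappa> * y$2"
      and k: "y$3 = 4 * kk y"
      by (simp_all add: ee kk)
    note rows = characteristic_rows_reduce[OF W dW[OF that] e k ww dWH[OF that] dM[OF that]
        dWU[OF that] dWJ[OF that] r1_def r2_def r3_def r4_def nz(3)]
    show "r1 y = l * y$5 - t * ((\<beta> + U / 2) * y$2 - ww y)"
      "l * dT y + t * T * y$2 = 4 * P * r2 y"
      "WH * (t * T * kk y - l * dKw y) = P * (r4 y + M * r2 y)"
      "l * T * kk y / 2 + l * Kw * y$2 / 2 + t * T * ee y - t * \<kappa> * T * y$2
        = P * r3 y + P * M * r1 y + (\<beta> + U / 2) * (t * T * kk y - l * dKw y) - 2 * \<kappa> * P * r2 y"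
      "l * dKk y + l * T * y$2 / 2 - t * T * ww y
       = 4 * P * l * dWJ y - (\<beta> + U / 2) * (4 * P * r2 y) - T * r1 y"
      by (fact rows)+
  qed
  \<comment> \<open>On \<open>z y = 0\<close> the linearised constraint reduces to
    \<open>T * y$5 = 0\<close>, so a nonzero solution has nonzero image.\<close>
  have zeqI: "y = 0" if "z y = 0" "y$6 = 0" "dWJ y = 0" for y
  proof -
    have 0: "ee y = 0" "kk y = 0" "ww y = 0" "y$2 = 0"
      using that(1) by (simp_all add: vec_eq_iff forall_4 z_def)
    have "T * y$5 = 0"
      using dWJ[OF that(2)] 0 that(3) by (simp add: dT dKk)
    then have y5: "y$5 = 0" using nz by simp
    have y3: "y$3 = 0" using 0(2) kk by simp
    show ?thesis
      using 0 y5 y3 that(2) by (simp add: vec_eq_iff forall_6 ee ww)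
  qed
  \<comment> \<open>The explicit vector solves the linear relations for (H, U, J, \<gamma>) with the
    variation \<open>B\<close> of \<beta> left free.\<close>
  have lift: "(z y = x \<and> y$6 = 0 \<and> y$5 = B)"
    if "y = vector [4 * x$1 - 4 * \<beta> * x$2 - 4 * \<kappa> * B - 2 * U * x$2 - 2 * \<kappa> * x$4, x$4, 4 * x$2,
                    \<beta> * x$4 + U * B + U * x$4 / 2 - x$3, B, 0]" for x :: "'a ^ 4" and B y
    unfolding that z_def vec_eq_iff forall_4 by (simp add: ee kk ww field_simps)
  have "?lhs \<longleftrightarrow> (\<exists>x. x \<noteq> 0 \<and> ?A *v x = 0)"
  proof
    assume ?lhs
    then obtain y where y: "y \<noteq> 0" "y$6 = 0" "dWJ y = 0" "r1 y = 0" "r2 y = 0" "r3 y = 0" "r4 y = 0"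
      unfolding r1_def r2_def r3_def r4_def by auto
    have "z y \<noteq> 0" using zeqI y by blast
    moreover have "t * T * kk y - l * dKw y = 0"
      using red(3)[OF y(2)] y WH by simp
    then have "?A *v z y = 0"
      unfolding ker using red(2,4,5)[OF y(2)] y by simp
    ultimately show "\<exists>x. x \<noteq> 0 \<and> ?A *v x = 0" by blast
  next
    assume "\<exists>x. x \<noteq> 0 \<and> ?A *v x = 0"
    then obtain x where x: "x \<noteq> 0" "?A *v x = 0" by blast
    have "\<exists>y. y \<noteq> 0 \<and> y$6 = 0 \<and> dWJ y = 0 \<and> r1 y = 0 \<and> ?A *v z y = 0"
    proof (cases "l = 0")
      case False
      \<comment> \<open>This value solves \<open>r1 y = 0\<close>. The last row then yields
        \<open>4 * P * l * dWJ y = 0\<close>, where \<open>l\<close> can be cancelled.\<close>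
      define B where "B = t * ((\<beta> + U / 2) * x$4 - x$3) / l"
      obtain y where y: "z y = x" "y$6 = 0" "y$5 = B"
        using lift by blast
      have r1: "r1 y = 0"
        using red(1)[OF y(2)] y False by (auto simp: B_def z_def vec_eq_iff forall_4)
      have k: "?A *v z y = 0" using x y by simp
      have "P * r2 y = 0" using k red(2)[OF y(2)] unfolding ker by simp
      then have "r2 y = 0" using nz by simp
      then have "4 * P * l * dWJ y = 0"
        using k red(5)[OF y(2)] r1 unfolding ker by simp
      then have "dWJ y = 0" using nz False by simp
      moreover have "y \<noteq> 0"
      proof
        assume "y = 0"
        then have "z y = 0" by (simp add: z_def vec_eq_iff forall_4 ee kk ww)
        then show False using x y by simp
      qed
      ultimately show ?thesis using r1 k y by blast
    next
      case True
      \<comment> \<open>Here \<open>b\<close> cannot be read off from \<open>r1\<close>, but \<open>t \<noteq> 0\<close> makes the reduced matrix regular,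
        and for \<open>t = 0\<close> only \<open>dWJ y = 0\<close> has to be solved.\<close>
      obtain y0 where y0: "z y0 = x" "y0$6 = 0"
        using lift[of _ x 0] by blast
      have k0: "?A *v z y0 = 0" using x y0 by simp
      have "t = 0"
      proof (rule ccontr)
        assume "t \<noteq> 0"
        then have "y0$2 = 0" "kk y0 = 0" "ww y0 = 0" "ee y0 = 0"
          using k0[unfolded ker] nz(2) True by auto
        then have "z y0 = 0" by (simp add: z_def vec_eq_iff forall_4)
        then show False using x y0 by simp
      qed
      \<comment> \<open>With \<open>l = t = 0\<close> the matrix vanishes, so any vector lies in its
        kernel. The direction of \<omega> is taken, for which \<open>dT y = d\<close> and
        \<open>dKk y = e\<close>, and \<open>B\<close> solves \<open>dWJ y = 0\<close>.\<close>
      define B where "B = - (d * (\<beta> + U / 2) + e) / T"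
      obtain y where y: "z y = vector [0, 0, 1, 0]" "y$6 = 0" "y$5 = B"
        using lift by blast
      have zy: "ee y = 0" "kk y = 0" "ww y = 1" "y$2 = 0"
        using y(1) by (simp_all add: z_def vec_eq_iff forall_4)
      have "4 * P * dWJ y = 0"
        unfolding dWJ[OF y(2)] dT dKk zy y(3) B_def using nz by simp
      then have "dWJ y = 0" using nz by simp
      moreover have "y \<noteq> 0" using zy(3) ww by auto
      moreover have "r1 y = 0" using red(1)[OF y(2)] True \<open>t = 0\<close> by simp
      moreover have "?A *v z y = 0"
        unfolding ker using True \<open>t = 0\<close> by simp
      ultimately show ?thesis using y by blast
    qed
    then obtain y where y: "y \<noteq> 0" "y$6 = 0" "dWJ y = 0" "r1 y = 0" "?A *v z y = 0" by blast
    have k: "l * dT y + t * T * y$2 = 0" "t * T * kk y - l * dKw y = 0"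
      "l * T * kk y / 2 + l * Kw * y$2 / 2 + t * T * ee y - t * \<kappa> * T * y$2 = 0"
      using y(5) unfolding ker by auto
    have r2: "r2 y = 0"
      using red(2)[OF y(2)] k(1) nz by simp
    have "P * r3 y = 0"
      using red(4)[OF y(2)] k(2,3) r2 y(4) by simp
    moreover have "P * r4 y = 0"
      using red(3)[OF y(2)] k(2) r2 by simp
    ultimately show ?lhs
      using y r2 nz unfolding r1_def r2_def r3_def r4_def by auto
  qed
  then show ?thesis by (simp add: det_eq_0_iff_kernel)
qed

section \<open>Gradients\<close>

lemma has_derivative_vec_nth [derivative_intros]:
  "(g has_derivative g') F \<Longrightarrow> ((\<lambda>x. g x $ i) has_derivative (\<lambda>h. g' h $ i)) F"
  by (rule bounded_linear.has_derivative[OF bounded_linear_vec_nth])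

definition grad :: "(real ^ 'n \<Rightarrow> real) \<Rightarrow> real ^ 'n \<Rightarrow> real ^ 'n" where
  "grad G p = (\<chi> i. pd i G p)"

lemma pd_eqI:
  assumes "(G has_derivative G') (at p)"
  shows "pd i G p = G' (axis i 1)"
proof -
  have line: "((\<lambda>t. p + t *\<^sub>R axis i 1) has_derivative (\<lambda>t. t *\<^sub>R axis i 1)) (at (0::real))"
    by (auto intro!: derivative_eq_intros)
  have "((\<lambda>t. G (p + t *\<^sub>R axis i 1)) has_derivative (\<lambda>t. G' (t *\<^sub>R axis i 1))) (at (0::real))"
    using has_derivative_compose[OF line, of G G'] assms by simp
  moreover have "(\<lambda>t. G' (t *\<^sub>R axis i 1)) = (\<lambda>t. G' (axis i 1) * t)"
    using linear_scale[OF has_derivative_linear[OF assms]] by (auto simp: fun_eq_iff)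
  ultimately show ?thesis
    unfolding pd_def by (intro DERIV_imp_deriv) (simp add: has_field_derivative_def)
qed

lemma pd_eq_nthI: "(G has_derivative (\<lambda>h. g \<bullet> h)) (at p) \<Longrightarrow> pd i G p = g $ i"
  by (simp add: pd_eqI inner_axis)

lemma has_derivative_gradI:
  assumes "G differentiable (at p)"
  shows "(G has_derivative (\<lambda>h. grad G p \<bullet> h)) (at p)"
proof -
  obtain G' where G': "(G has_derivative G') (at p)"
    using assms by (auto simp: differentiable_def)
  have "G' h = grad G p \<bullet> h" for h
  proof -
    have "G' h = G' (\<Sum>i\<in>UNIV. h $ i *\<^sub>R axis i 1)"
      by (simp add: basis_expansion scalar_mult_eq_scaleR[symmetric])
    also have "\<dots> = (\<Sum>i\<in>UNIV. h $ i * G' (axis i 1))"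
      using has_derivative_linear[OF G'] by (simp add: linear_sum linear_scale)
    finally show ?thesis
      by (simp add: grad_def inner_vec_def pd_eqI[OF G'] mult.commute)
  qed
  then have "G' = (\<lambda>h. grad G p \<bullet> h)" by auto
  with G' show ?thesis by simp
qed

lemma C1_onD:
  assumes "C1_on S G" "open S"
  shows "p \<in> S \<Longrightarrow> (G has_derivative (\<lambda>h. grad G p \<bullet> h)) (at p)"
    and "continuous_on S (grad G)" and "continuous_on S G"
proof -
  show "p \<in> S \<Longrightarrow> (G has_derivative (\<lambda>h. grad G p \<bullet> h)) (at p)"
    using assms by (auto simp: C1_on_def differentiable_on_eq_differentiable_at intro: has_derivative_gradI)
  show "continuous_on S (grad G)"
    using assms unfolding C1_on_def grad_def[abs_def] by (auto intro: continuous_on_vec_lambda)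
  show "continuous_on S G"
    using assms unfolding C1_on_def by (auto intro: differentiable_imp_continuous_on)
qed

lemma C1_onI:
  assumes "open S" "\<And>p. p \<in> S \<Longrightarrow> (G has_derivative (\<lambda>h. g p \<bullet> h)) (at p)" "continuous_on S g"
  shows "C1_on S G"
proof -
  have "continuous_on S (\<lambda>p. g p $ i)" for i
    by (intro continuous_intros assms)
  then have "continuous_on S (pd i G)" for i
    by (rule continuous_on_eq) (simp add: pd_eqI[OF assms(2)] inner_axis)
  then show ?thesis
    using assms(1,2) unfolding C1_on_def
    by (auto simp: differentiable_on_eq_differentiable_at differentiable_def)
qed

section \<open>The parameter map, the relation between \<open>W\<close> and \<open>K\<close>, and
  the graphs\<close>

text \<open>The transposed Jacobian of \<open>lin_params\<close> at \<open>q\<close>, applied to \<open>k\<close>.\<close>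

definition lin_grad :: "real ^ 4 \<Rightarrow> real ^ 6 \<Rightarrow> real ^ 6" where
  "lin_grad k q =
     (k $ 1 / 4) *\<^sub>R (axis 1 1 + q $ 5 *\<^sub>R axis 3 1 + q $ 3 *\<^sub>R axis 5 1
        + (q $ 3 / 2) *\<^sub>R axis 2 1 + (q $ 2 / 2) *\<^sub>R axis 3 1)
     + (k $ 2 / 4) *\<^sub>R axis 3 1
     + k $ 3 *\<^sub>R (q $ 5 *\<^sub>R axis 2 1 + q $ 2 *\<^sub>R axis 5 1 + (q $ 2 / 2) *\<^sub>R axis 2 1 - axis 4 1)
     + k $ 4 *\<^sub>R axis 6 1"

lemma lin_grad_nth:
  "lin_grad k q $ 1 = k $ 1 / 4" "lin_grad k q $ 2 = k $ 1 * q $ 3 / 8 + k $ 3 * (q $ 5 + q $ 2 / 2)"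
  "lin_grad k q $ 3 = k $ 1 * (q $ 5 + q $ 2 / 2) / 4 + k $ 2 / 4" "lin_grad k q $ 4 = - k $ 3"
  "lin_grad k q $ 5 = k $ 1 * q $ 3 / 4 + k $ 3 * q $ 2"
  by (simp_all add: lin_grad_def axis_def field_simps)

lemma lin_params_eq:
  "lin_params q =
     ((q $ 1 + q $ 5 * q $ 3 + q $ 2 * q $ 3 / 2) / 4) *\<^sub>R axis 1 1 + (q $ 3 / 4) *\<^sub>R axis 2 1
     + (q $ 5 * q $ 2 + (q $ 2)\<^sup>2 / 4 - q $ 4) *\<^sub>R axis 3 1 + q $ 6 *\<^sub>R axis 4 1"
  by (simp add: lin_params_def vec_eq_iff forall_4 axis_def)

lemma continuous_on_lin_params: "continuous_on S lin_params"
  unfolding lin_params_eq[abs_def] by (intro continuous_intros) auto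

text \<open>Chain rule with the Jacobian \<open>l'\<close> moved from the increment to the gradient,
  where it becomes its transpose \<open>lin_grad\<close>.\<close>

lemma has_derivative_comp_lin_params:
  assumes "(k has_derivative (\<lambda>h. g \<bullet> h)) (at (lin_params q))"
  shows "((\<lambda>q. k (lin_params q)) has_derivative (\<lambda>h. lin_grad g q \<bullet> h)) (at q)"
proof -
  define l' where "l' h = ((h $ 1 + q $ 5 * h $ 3 + h $ 5 * q $ 3 + (q $ 2 * h $ 3 + h $ 2 * q $ 3) / 2) / 4) *\<^sub>R (axis 1 1 :: real ^ 4)
     + (h $ 3 / 4) *\<^sub>R axis 2 1
     + (q $ 5 * h $ 2 + h $ 5 * q $ 2 + q $ 2 * h $ 2 / 2 - h $ 4) *\<^sub>R axis 3 1 + h $ 6 *\<^sub>R axis 4 1"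
    for h :: "real ^ 6"
  have "(lin_params has_derivative l') (at q)"
    unfolding lin_params_eq[abs_def] l'_def
    by (auto intro!: derivative_eq_intros simp: fun_eq_iff vec_eq_iff forall_4 axis_def field_simps)
  from has_derivative_compose[OF this assms]
  have "((\<lambda>q. k (lin_params q)) has_derivative (\<lambda>h. g \<bullet> l' h)) (at q)" .
  moreover have "g \<bullet> l' h = lin_grad g q \<bullet> h" for h
    by (simp add: l'_def lin_grad_def inner_add_left inner_diff_left inner_add_right inner_axis inner_axis'
        field_simps)
  ultimately show ?thesis by simp
qed

lemma continuous_on_lin_grad:
  assumes "continuous_on S g"
  shows "continuous_on S (\<lambda>q. lin_grad (g q) q)"
  unfolding lin_grad_def by (intro continuous_intros assms) auto

text \<open>The integrand contributes a second factor \<open>sqrt 2\<close>, which turns the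
  prefactor of \<open>W\<close> into \<open>2 / pi\<close>.\<close>

lemma whitham_W_eq: "whitham_W F am ap q = action F am ap (lin_params q) / pi"
proof -
  have "sqrt (q $ 1 + q $ 5 * q $ 3 + q $ 2 * q $ 3 / 2
                   - 2 * R\<^sup>2 * (q $ 5 * q $ 2 + (q $ 2)\<^sup>2 / 4 - q $ 4)
                   - (q $ 3)\<^sup>2 / (8 * R\<^sup>2) - 2 * q $ 6 * F (R\<^sup>2))
      = sqrt 2 * sqrt (radicand F (lin_params q) R)" for R
    unfolding real_sqrt_mult[symmetric] radicand_def lin_params_def
    by (simp add: algebra_simps power2_eq_square)
  then show ?thesis
    by (simp add: whitham_W_def action_def mult.assoc[symmetric])
qed

lemma graph_has_derivative:
  assumes "(g has_derivative g') (at v)"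
  shows "(graph_H \<zeta> g has_derivative (\<lambda>w. vector [g' w, w $ 3, w $ 1, w $ 2, w $ 4, 0])) (at v)"
    and "(graph_J \<zeta> g has_derivative (\<lambda>w. vector [w $ 1, w $ 3, g' w, w $ 2, w $ 4, 0])) (at v)"
proof -
  have vec: "vector [a, b, c, d, e, f] = a *\<^sub>R axis 1 1 + b *\<^sub>R axis 2 1 + c *\<^sub>R axis 3 1 + d *\<^sub>R axis 4 1
      + e *\<^sub>R axis 5 1 + f *\<^sub>R (axis 6 1 :: real ^ 6)" for a b c d e f
    by (simp add: vec_eq_iff forall_6 axis_def)
  show "(graph_H \<zeta> g has_derivative (\<lambda>w. vector [g' w, w $ 3, w $ 1, w $ 2, w $ 4, 0])) (at v)"
    and "(graph_J \<zeta> g has_derivative (\<lambda>w. vector [w $ 1, w $ 3, g' w, w $ 2, w $ 4, 0])) (at v)"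
    unfolding graph_H_def[abs_def] graph_J_def[abs_def] vec
    by (auto intro!: derivative_eq_intros assms simp: fun_eq_iff)
qed

section \<open>Solving the constraint\<close>

text \<open>The gradient of \<open>g\<close> is given by its explicit quotient at all points of
  \<open>V\<close>, so that its continuity shows \<open>g\<close> to be continuously differentiable
  there.\<close>

lemma scalar_implicit_function:
  fixes \<Phi> :: "real \<times> 'a::euclidean_space \<Rightarrow> real"
  assumes "open S"
    and deriv: "\<And>x. x \<in> S \<Longrightarrow> (\<Phi> has_derivative (\<lambda>d. D x \<bullet> d)) (at x)"
    and cont: "continuous_on S D"
    and x0: "(h0, v0) \<in> S" and nz: "fst (D (h0, v0)) \<noteq> 0"
  obtains g V where "open V" "v0 \<in> V" "g v0 = h0"
    and "\<And>v. v \<in> V \<Longrightarrow> (g v, v) \<in> S \<and> \<Phi> (g v, v) = \<Phi> (h0, v0)"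
    and "\<And>v. v \<in> V \<Longrightarrow> (g has_derivative (\<lambda>w. (- snd (D (g v, v)) /\<^sub>R fst (D (g v, v))) \<bullet> w)) (at v)"
    and "continuous_on V (\<lambda>v. - snd (D (g v, v)) /\<^sub>R fst (D (g v, v)))"
proof -
  \<comment> \<open>The graph of \<open>g\<close> is the preimage of a slice under \<open>\<Psi> (h, v) = (\<Phi> (h, v), v)\<close>.\<close>
  define S' where "S' = S \<inter> (\<lambda>x. fst (D x)) -` (- {0})"
  have S': "open S'"
    unfolding S'_def using assms(1) cont
    by (intro continuous_open_preimage continuous_intros) auto
  define emb :: "real \<Rightarrow>\<^sub>L (real \<times> 'a)" where "emb = Blinfun (\<lambda>r. (r, 0))"
  define prj :: "(real \<times> 'a) \<Rightarrow>\<^sub>L (real \<times> 'a)" where "prj = Blinfun (\<lambda>d. (0, snd d))"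
  have emb: "emb r = (r, 0)" for r
    unfolding emb_def by (subst bounded_linear_Blinfun_apply) (auto intro!: bounded_linear_intros)
  have prj: "prj d = (0, snd d)" for d
    unfolding prj_def by (subst bounded_linear_Blinfun_apply) (auto intro!: bounded_linear_intros)
  define \<Psi> where "\<Psi> x = (\<Phi> x, snd x)" for x
  define \<Psi>' where "\<Psi>' x = (emb o\<^sub>L blinfun_inner_right (D x)) + prj" for x
  have \<Psi>': "\<Psi>' x d = (D x \<bullet> d, snd d)" for x d
    by (simp add: \<Psi>'_def emb prj blinfun.add_left)
  have d\<Psi>: "(\<Psi> has_derivative \<Psi>' x) (at x)" if "x \<in> S'" for x
  proof -
    have "x \<in> S" using that by (simp add: S'_def)
    then show ?thesis
      unfolding \<Psi>'[abs_def] \<Psi>_def[abs_def]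
      by (intro has_derivative_Pair deriv has_derivative_snd has_derivative_ident)
  qed
  have c\<Psi>: "continuous_on S' \<Psi>'"
    unfolding \<Psi>'_def[abs_def]
    by (intro continuous_intros bounded_linear.continuous_on[OF bounded_linear_blinfun_inner_right]
        continuous_on_subset[OF cont]) (auto simp: S'_def)
  define a where "a = fst (D (h0, v0))"
  define b where "b = snd (D (h0, v0))"
  \<comment> \<open>At the base point the derivative of \<open>\<Psi>\<close> sends
    \<open>(r, w)\<close> to \<open>(a * r + b \<bullet> w, w)\<close>, which is inverted by solving
    for \<open>r\<close>.\<close>
  define inverse' :: "(real \<times> 'a) \<Rightarrow>\<^sub>L (real \<times> 'a)"
    where "inverse' = Blinfun (\<lambda>d. ((fst d - b \<bullet> snd d) / a, snd d))"
  have "bounded_linear (\<lambda>d. (fst d - b \<bullet> snd d) / a)"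
    by (intro bounded_linear_compose[OF bounded_linear_divide, of "\<lambda>d. fst d - b \<bullet> snd d"]
        bounded_linear_sub bounded_linear_fst bounded_linear_compose[OF bounded_linear_inner_right bounded_linear_snd])
  then have inv: "inverse' d = ((fst d - b \<bullet> snd d) / a, snd d)" for d
    unfolding inverse'_def by (subst bounded_linear_Blinfun_apply) (auto intro!: bounded_linear_Pair bounded_linear_snd)
  have "inverse' o\<^sub>L \<Psi>' (h0, v0) = id_blinfun"
    using nz by (intro blinfun_eqI) (simp add: inv \<Psi>' a_def b_def inner_prod_def)
  moreover have "(h0, v0) \<in> S'" using x0 nz by (simp add: S'_def)
  ultimately obtain U V G G' where
      UV: "open U" "U \<subseteq> S'" "(h0, v0) \<in> U" "open V" "\<Psi> (h0, v0) \<in> V" "homeomorphism U V \<Psi> G"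
      "\<And>y. y \<in> V \<Longrightarrow> (G has_derivative G' y) (at y)"
    using inverse_function_theorem[OF S' d\<Psi> c\<Psi>] by metis
  define g where "g v = fst (G (\<Phi> (h0, v0), v))" for v
  define V' where "V' = (\<lambda>v. (\<Phi> (h0, v0), v)) -` V"
  have G: "G (\<Phi> (h0, v0), v) = (g v, v) \<and> (g v, v) \<in> U \<and> \<Phi> (g v, v) = \<Phi> (h0, v0)" if "v \<in> V'" for v
  proof -
    let ?y = "(\<Phi> (h0, v0), v)"
    have y: "?y \<in> V" using that by (simp add: V'_def)
    have 1: "\<Psi> (G ?y) = ?y" and 2: "G ?y \<in> U"
      using UV(6) y by (auto simp: homeomorphism_def)
    have eq: "G ?y = (g v, v)" using 1 by (simp add: \<Psi>_def g_def prod_eq_iff)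
    then show ?thesis using 1 2 by (simp add: \<Psi>_def)
  qed
  have gdiff: "(g has_derivative (\<lambda>w. (- snd (D (g v, v)) /\<^sub>R fst (D (g v, v))) \<bullet> w)) (at v)" if v: "v \<in> V'" for v
  proof -
    let ?y = "(\<Phi> (h0, v0), v)" and ?D = "D (g v, v)"
    have y: "?y \<in> V" using v by (simp add: V'_def)
    \<comment> \<open>The local inverse shows that \<open>g\<close> is differentiable; its
      derivative is then identified by differentiating the constant
      \<open>\<Phi> (g v, v)\<close>.\<close>
    have pair: "((\<lambda>v. (\<Phi> (h0, v0), v)) has_derivative (\<lambda>w. (0, w))) (at v)"
      by (auto intro!: derivative_eq_intros)
    have "((\<lambda>v. fst (G (\<Phi> (h0, v0), v))) has_derivative (\<lambda>w. fst (G' ?y (0, w)))) (at v)"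
      by (intro has_derivative_fst has_derivative_compose[OF pair UV(7)[OF y]])
    then have g': "(g has_derivative (\<lambda>w. fst (G' ?y (0, w)))) (at v)"
      by (simp add: g_def[abs_def])
    define g' where "g' w = fst (G' ?y (0, w))" for w
    have in_S: "(g v, v) \<in> S'" using G[OF v] UV(2) by auto
    have "((\<lambda>v. (g v, v)) has_derivative (\<lambda>w. (g' w, w))) (at v)"
      using g' unfolding g'_def[symmetric] by (auto intro!: derivative_eq_intros)
    from has_derivative_compose[OF this deriv] in_S
    have "((\<lambda>v. \<Phi> (g v, v)) has_derivative (\<lambda>w. ?D \<bullet> (g' w, w))) (at v)"
      by (simp add: S'_def)
    moreover have "open V'"
      unfolding V'_def by (intro open_vimage UV continuous_intros)
    then have "((\<lambda>v. \<Phi> (g v, v)) has_derivative (\<lambda>w. 0)) (at v)"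
      by (rule has_derivative_transform_within_open[OF has_derivative_const _ v]) (use G in auto)
    ultimately have "(\<lambda>w. ?D \<bullet> (g' w, w)) = (\<lambda>w. 0)"
      by (rule has_derivative_unique)
    from fun_cong[OF this] have "fst ?D * g' w + snd ?D \<bullet> w = 0" for w
      by (simp add: inner_prod_def)
    then have "g' = (\<lambda>w. (- snd ?D /\<^sub>R fst ?D) \<bullet> w)"
      using in_S by (auto simp: S'_def fun_eq_iff field_simps add_eq_0_iff)
    then show ?thesis using g' unfolding g'_def[symmetric] by simp
  qed
  show thesis
  proof (rule that[of V' g])
    show V': "open V'"
      unfolding V'_def by (intro open_vimage UV continuous_intros)
    show v0: "v0 \<in> V'" using UV(5) by (simp add: V'_def \<Psi>_def)
    have "G (\<Psi> (h0, v0)) = (h0, v0)"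
      using UV(3,6) by (auto simp: homeomorphism_def)
    then show "g v0 = h0" by (simp add: g_def \<Psi>_def)
    show "(g v, v) \<in> S \<and> \<Phi> (g v, v) = \<Phi> (h0, v0)" if "v \<in> V'" for v
      using G[OF that] UV(2) by (auto simp: S'_def)
    show "(g has_derivative (\<lambda>w. (- snd (D (g v, v)) /\<^sub>R fst (D (g v, v))) \<bullet> w)) (at v)" if "v \<in> V'" for v
      by (rule gdiff[OF that])
    have "continuous_on V' g"
      using gdiff V' by (meson continuous_at_imp_continuous_on has_derivative_continuous)
    then have "continuous_on V' (\<lambda>v. D (g v, v))"
      by (intro continuous_on_compose2[OF cont] continuous_intros) (use G UV(2) S'_def in auto)
    then show "continuous_on V' (\<lambda>v. - snd (D (g v, v)) /\<^sub>R fst (D (g v, v)))"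
      by (intro continuous_intros) (use G UV(2) S'_def in auto)
  qed
qed

text \<open>The affine form of \<open>graph\<close> covers both parametrisations, with
  \<open>i\<close> the coordinate solved for. Composing \<open>W_J\<close> with the affine map
  \<open>c + A x\<close> reduces the claim to the scalar implicit function theorem.\<close>

lemma implicit_solution_exists:
  fixes W :: "real ^ 6 \<Rightarrow> real" and graph :: "(real ^ 4 \<Rightarrow> real) \<Rightarrow> real ^ 4 \<Rightarrow> real ^ 6"
  assumes S: "open S" and C1: "C1_on S (pd 3 W)"
    and graph: "\<And>g v. graph g v = c + (g v *\<^sub>R axis i 1 + E v)" and E: "bounded_linear E"
    and q: "graph (\<lambda>_. h0) v0 \<in> S" "pd 3 W (graph (\<lambda>_. h0) v0) = 0"
      "pd i (pd 3 W) (graph (\<lambda>_. h0) v0) \<noteq> 0"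
  shows "\<exists>g. implicit_solution W graph v0 h0 g"
proof -
  interpret E: bounded_linear E by (rule E)
  define A where "A x = (fst x *\<^sub>R axis i 1 + E (snd x) :: real ^ 6)" for x :: "real \<times> (real ^ 4)"
  have A: "bounded_linear A"
    unfolding A_def[abs_def]
    by (intro bounded_linear_add bounded_linear_scaleR_const bounded_linear_fst
        bounded_linear_compose[OF E bounded_linear_snd])
  define \<Phi> where "\<Phi> x = pd 3 W (c + A x)" for x
  define D where "D x = adjoint A (grad (pd 3 W) (c + A x))" for x
  have gr: "graph g v = c + A (g v, v)" for g v by (simp add: graph A_def)
  have linA: "linear A" using A by (rule bounded_linear.linear)
  define T where "T = (\<lambda>x. c + A x) -` S"
  have cA: "continuous_on X (\<lambda>x. c + A x)" for X
    by (intro continuous_intros linear_continuous_on A)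
  have "open T" unfolding T_def by (intro open_vimage S cA)
  moreover have "(\<Phi> has_derivative (\<lambda>d. D x \<bullet> d)) (at x)" if "x \<in> T" for x
  proof -
    have "((\<lambda>x. c + A x) has_derivative A) (at x)"
      using bounded_linear.has_derivative[OF A has_derivative_ident] by (auto intro!: derivative_eq_intros)
    from has_derivative_compose[OF this C1_onD(1)[OF C1 S]] that
    show ?thesis
      unfolding \<Phi>_def D_def T_def by (simp add: adjoint_clauses[OF linA])
  qed
  moreover have "continuous_on T D"
  proof -
    have "bounded_linear (adjoint A)"
      using adjoint_linear[OF linA] by (simp add: linear_conv_bounded_linear)
    moreover have "continuous_on T (\<lambda>x. grad (pd 3 W) (c + A x))"
      by (rule continuous_on_compose2[OF C1_onD(2)[OF C1 S] cA]) (auto simp: T_def)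
    ultimately show ?thesis unfolding D_def by (rule bounded_linear.continuous_on)
  qed
  moreover have "(h0, v0) \<in> T" using q(1) by (simp add: T_def gr)
  \<comment> \<open>The adjoint moves the pairing with \<open>(1, 0)\<close> to
    \<open>A (1, 0) = axis i 1\<close>, which gives the partial derivative of \<open>W_J\<close> in
    direction \<open>i\<close>.\<close>
  moreover have "fst (D (h0, v0)) = D (h0, v0) \<bullet> (1, 0)" by (simp add: inner_prod_def)
  then have "fst (D (h0, v0)) \<noteq> 0"
    using q(3) unfolding D_def gr adjoint_clauses[OF linA]
    by (simp add: A_def E.zero inner_axis grad_def)
  ultimately obtain g V where g: "open V" "v0 \<in> V" "g v0 = h0"
     "\<And>v. v \<in> V \<Longrightarrow> (g v, v) \<in> T \<and> \<Phi> (g v, v) = \<Phi> (h0, v0)"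
     "\<And>v. v \<in> V \<Longrightarrow> (g has_derivative (\<lambda>w. (- snd (D (g v, v)) /\<^sub>R fst (D (g v, v))) \<bullet> w)) (at v)"
     "continuous_on V (\<lambda>v. - snd (D (g v, v)) /\<^sub>R fst (D (g v, v)))"
    by (rule scalar_implicit_function) blast+
  have "\<Phi> (h0, v0) = 0" using q(2) by (simp add: \<Phi>_def gr)
  then have "pd 3 W (graph g v) = 0" if "v \<in> V" for v
    using g(4)[OF that] by (simp add: gr \<Phi>_def)
  then show ?thesis
    unfolding implicit_solution_def using g C1_onI[OF g(1,5,6)] by blast
qed

section \<open>Euler's identity for the action\<close>

text \<open>The value \<open>deriv\<close> in \<open>turning_points\<close> carries information only
  where the radicand is differentiable; \<open>F\<close> being differentiable on the positive axis
  ensures this.\<close>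

lemma radicand_has_real_derivative:
  assumes F: "\<And>x. x > 0 \<Longrightarrow> (F has_real_derivative f x) (at x)" and "A > 0"
  shows "(radicand F p has_real_derivative deriv (radicand F p) A) (at A)"
proof -
  have "((\<lambda>A. F (A\<^sup>2)) has_real_derivative f (A\<^sup>2) * (2 * A)) (at A)"
    using \<open>A > 0\<close> by (intro DERIV_chain2[OF F]) (auto intro!: derivative_eq_intros)
  then have "\<exists>d. (radicand F p has_real_derivative d) (at A)"
    unfolding radicand_def[abs_def] using \<open>A > 0\<close>
    by (intro exI) (auto intro!: derivative_eq_intros)
  then show ?thesis by (auto simp: DERIV_deriv_iff_real_differentiable real_differentiable_def)
qed

text \<open>At a root the difference quotient is \<open>g y / (y - x)\<close>; as its limit
  \<open>d\<close> is nonzero, \<open>g\<close> has no zero near \<open>x\<close> other than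
  \<open>x\<close>.\<close>

lemma simple_root_isolated:
  fixes g :: "real \<Rightarrow> real"
  assumes "(g has_real_derivative d) (at x)" "d \<noteq> 0" "g x = 0"
  shows "eventually (\<lambda>y. g y = 0 \<longrightarrow> y = x) (nhds x)"
proof -
  have "((\<lambda>y. (g y - g x) / (y - x)) \<longlongrightarrow> d) (at x)"
    using assms(1) by (simp add: has_field_derivative_iff)
  then have "eventually (\<lambda>y. (g y - g x) / (y - x) \<noteq> 0) (at x)"
    using assms(2) by (rule tendsto_imp_eventually_ne)
  then have "eventually (\<lambda>y. g y \<noteq> 0) (at x)"
    by (rule eventually_mono) (use assms(3) in auto)
  then show ?thesis
    by (auto simp: eventually_at_filter elim: eventually_mono)
qed

text \<open>The radicand scales by \<open>s\<close> along this curve, so its roots do not move.\<close>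

definition scale_params :: "real ^ 4 \<Rightarrow> real \<Rightarrow> real ^ 4" where
  "scale_params p s = vector [s * p $ 1, sqrt s * p $ 2, s * p $ 3, s * p $ 4]"

lemma radicand_scale_params: "s > 0 \<Longrightarrow> radicand F (scale_params p s) A = s * radicand F p A"
  by (simp add: radicand_def scale_params_def power_mult_distrib algebra_simps)

lemma scale_params_1: "scale_params p 1 = p"
  by (simp add: scale_params_def vec_eq_iff forall_4)

lemma scale_params_has_derivative:
  "(scale_params p has_derivative (\<lambda>t. t *\<^sub>R vector [p $ 1, p $ 2 / 2, p $ 3, p $ 4])) (at 1)"
proof -
  have eq: "scale_params p s = s *\<^sub>R (p $ 1 *\<^sub>R axis 1 1 + p $ 3 *\<^sub>R axis 3 1 + p $ 4 *\<^sub>R axis 4 1)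
      + sqrt s *\<^sub>R (p $ 2 *\<^sub>R axis 2 1)" for s
    by (simp add: scale_params_def vec_eq_iff forall_4 axis_def)
  have sq: "(sqrt has_derivative (\<lambda>t. t / 2)) (at 1)"
    using has_field_derivative_imp_has_derivative[OF DERIV_real_sqrt[of 1]]
    by (rule has_derivative_eq_rhs) (auto simp: fun_eq_iff)
  have "(scale_params p has_derivative (\<lambda>t. t *\<^sub>R (p $ 1 *\<^sub>R axis 1 1 + p $ 3 *\<^sub>R axis 3 1 + p $ 4 *\<^sub>R axis 4 1)
      + (t / 2) *\<^sub>R (p $ 2 *\<^sub>R axis 2 1))) (at 1)"
    unfolding eq[abs_def] by (intro has_derivative_add has_derivative_scaleR_left has_derivative_ident sq)
  then show ?thesis
    by (rule has_derivative_eq_rhs) (simp add: fun_eq_iff vec_eq_iff forall_4 axis_def)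
qed

text \<open>Along the scaling curve \<open>am\<close> and \<open>ap\<close> stay zeros of the
  unscaled radicand. They move continuously and simple zeros are isolated, so they are constant for
  \<open>s\<close> near 1, while the integrand acquires the factor \<open>sqrt s\<close>.\<close>

lemma action_scale_params:
  assumes F: "\<And>x. x > 0 \<Longrightarrow> (F has_real_derivative f x) (at x)"
    and branch: "root_branch F N am ap" and p: "p \<in> N"
  shows "eventually (\<lambda>s. action F am ap (scale_params p s) = sqrt s * action F am ap p) (nhds 1)"
proof -
  have N: "open N" and cont: "continuous_on N am" "continuous_on N ap"
    and tp: "\<And>p. p \<in> N \<Longrightarrow> turning_points F p (am p) (ap p)"
    using branch by (auto simp: root_branch_def)
  have "(scale_params p \<longlongrightarrow> scale_params p 1) (nhds 1)"
    using has_derivative_continuous[OF scale_params_has_derivative[of p]]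
    unfolding continuous_at tendsto_at_iff_tendsto_nhds .
  then have sp: "(scale_params p \<longlongrightarrow> p) (nhds 1)"
    by (simp add: scale_params_1)
  have ev_N: "eventually (\<lambda>s. scale_params p s \<in> N) (nhds 1)"
    by (rule topological_tendstoD[OF sp N p])
  have ev_pos: "eventually (\<lambda>s::real. s > 0) (nhds 1)"
    using eventually_nhds_in_open[of "{0<..}" "1::real"] by simp
  have root: "eventually (\<lambda>s. r (scale_params p s) = r p) (nhds 1)"
    if c: "continuous_on N r" and r: "\<And>p. p \<in> N \<Longrightarrow> r p > 0 \<and> radicand F p (r p) = 0 \<and> deriv (radicand F p) (r p) \<noteq> 0" for r
  proof -
    have "isCont r p" using c N p by (simp add: continuous_on_eq_continuous_at)
    then have "((\<lambda>s. r (scale_params p s)) \<longlongrightarrow> r p) (nhds 1)"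
      using sp by (rule isCont_tendsto_compose)
    moreover have "eventually (\<lambda>y. radicand F p y = 0 \<longrightarrow> y = r p) (nhds (r p))"
      using radicand_has_real_derivative[OF F] r[OF p] by (intro simple_root_isolated) auto
    ultimately have "eventually (\<lambda>s. radicand F p (r (scale_params p s)) = 0 \<longrightarrow> r (scale_params p s) = r p) (nhds 1)"
      unfolding filterlim_iff by blast
    then show ?thesis
      using ev_N ev_pos
    proof eventually_elim
      case (elim s)
      have "s * radicand F p (r (scale_params p s)) = 0"
        using r[OF elim(2)] radicand_scale_params[OF elim(3), of F p "r (scale_params p s)"] by simp
      then show ?case using elim by simp
    qed
  qed
  have "eventually (\<lambda>s. am (scale_params p s) = am p) (nhds 1)"
    by (rule root[OF cont(1)]) (use tp in \<open>auto simp: turning_points_def\<close>)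
  moreover have "eventually (\<lambda>s. ap (scale_params p s) = ap p) (nhds 1)"
    by (rule root[OF cont(2)]) (use tp in \<open>force simp: turning_points_def\<close>)
  ultimately show ?thesis
    using ev_pos
  proof eventually_elim
    case (elim s)
    then show ?case
      by (simp add: action_def radicand_scale_params real_sqrt_mult)
  qed
qed

text \<open>Both sides of the scaling law \<open>K (scale_params p s) = sqrt s * K p\<close> are
  differentiated at \<open>s = 1\<close>; the half at \<kappa> comes from scaling \<kappa> by
  \<open>sqrt s\<close>.\<close>

lemma euler_identity:
  assumes F: "\<And>x. x > 0 \<Longrightarrow> (F has_real_derivative f x) (at x)"
    and branch: "root_branch F N am ap" and p: "p \<in> N"
    and K: "K = action F am ap" and C1: "C1_on N K"
  shows "p $ 1 * pd 1 K p + p $ 2 / 2 * pd 2 K p + p $ 3 * pd 3 K p + p $ 4 * pd 4 K p = K p / 2"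
proof -
  have N: "open N" using branch by (simp add: root_branch_def)
  let ?e = "vector [p $ 1, p $ 2 / 2, p $ 3, p $ 4] :: real ^ 4"
  have "(K has_derivative (\<lambda>h. grad K p \<bullet> h)) (at (scale_params p 1))"
    using C1_onD(1)[OF C1 N p] by (simp add: scale_params_1)
  from has_derivative_compose[OF scale_params_has_derivative this]
  have 1: "((\<lambda>s. K (scale_params p s)) has_derivative (\<lambda>t. grad K p \<bullet> (t *\<^sub>R ?e))) (at 1)" .
  obtain T where T: "open T" "1 \<in> T" "\<And>s. s \<in> T \<Longrightarrow> K (scale_params p s) = sqrt s * K p"
    using action_scale_params[OF F branch p] unfolding K eventually_nhds by blast
  have "((\<lambda>s. sqrt s * K p) has_real_derivative K p / 2) (at 1)"
    by (auto intro!: derivative_eq_intros)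
  then have "((\<lambda>s. sqrt s * K p) has_derivative (\<lambda>t. K p / 2 * t)) (at 1)"
    unfolding has_field_derivative_def .
  then have 2: "((\<lambda>s. K (scale_params p s)) has_derivative (\<lambda>t. K p / 2 * t)) (at 1)"
    by (rule has_derivative_transform_within_open[OF _ T(1,2)]) (simp add: T(3))
  have "grad K p \<bullet> (1 *\<^sub>R ?e) = K p / 2 * 1"
    using has_derivative_unique[OF 1 2] by meson
  then show ?thesis by (simp add: inner_vec_def sum_4 grad_def mult.commute)
qed

text \<open>Euler's identity holds on the open set \<open>N\<close> and may be differentiated there.
  The terms with \<open>axis i 1\<close> come from the coefficients \<open>p $ j\<close>.\<close>

lemma euler_identity_derivative:
  assumes F: "\<And>x. x > 0 \<Longrightarrow> (F has_real_derivative f x) (at x)"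
    and branch: "root_branch F N am ap" and p: "p \<in> N"
    and K: "K = action F am ap" and reg: "regular_on N K"
  shows "p $ 1 * pd i (pd 1 K) p + p $ 2 / 2 * pd i (pd 2 K) p + p $ 3 * pd i (pd 3 K) p
      + p $ 4 * pd i (pd 4 K) p
      + (axis i 1 $ 1 * pd 1 K p + axis i 1 $ 2 / 2 * pd 2 K p + axis i 1 $ 3 * pd 3 K p + axis i 1 $ 4 * pd 4 K p)
      = pd i K p / 2"
proof -
  have N: "open N" using branch by (simp add: root_branch_def)
  have C1: "C1_on N K" "\<And>i. C1_on N (pd i K)" using reg by (auto simp: regular_on_def)
  let ?L = "\<lambda>p. p $ 1 * pd 1 K p + p $ 2 / 2 * pd 2 K p + p $ 3 * pd 3 K p + p $ 4 * pd 4 K p"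
  note d = C1_onD(1)[OF C1(1) N p] C1_onD(1)[OF C1(2) N p]
  have "((\<lambda>p. K p / 2) has_derivative (\<lambda>h. (grad K p \<bullet> h) / 2)) (at p)"
    by (auto intro!: derivative_eq_intros d)
  then have 1: "(?L has_derivative (\<lambda>h. (grad K p \<bullet> h) / 2)) (at p)"
    by (rule has_derivative_transform_within_open[OF _ N p])
       (use euler_identity[OF F branch _ K C1(1)] in simp)
  have 2: "(?L has_derivative (\<lambda>h. p $ 1 * (grad (pd 1 K) p \<bullet> h) + h $ 1 * pd 1 K p
      + (p $ 2 / 2 * (grad (pd 2 K) p \<bullet> h) + h $ 2 / 2 * pd 2 K p)
      + (p $ 3 * (grad (pd 3 K) p \<bullet> h) + h $ 3 * pd 3 K p)
      + (p $ 4 * (grad (pd 4 K) p \<bullet> h) + h $ 4 * pd 4 K p))) (at p)"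
    by (intro has_derivative_add has_derivative_mult d has_derivative_vec_nth has_derivative_ident
        bounded_linear.has_derivative[OF bounded_linear_divide]) 
  from fun_cong[OF has_derivative_unique[OF 1 2], of "axis i 1"] show ?thesis
    by (simp add: inner_axis grad_def algebra_simps)
qed

section \<open>The normal form as a determinant\<close>

text \<open>Each matrix of the normal form carries a factor \<sigma>, hence the
  \<open>2 \<times> 2\<close> determinant carries two; \<open>normal_form_identity\<close> supplies
  the third. Substituting \<open>\<i> * t\<close> for \<mu> makes all coefficients real.\<close>

lemma normal_form_eq_det:
  assumes F: "\<And>x. x > 0 \<Longrightarrow> (F has_real_derivative f x) (at x)"
    and branch: "root_branch F N am ap" and p: "p \<in> N"
    and K: "K = action F am ap" and reg: "regular_on N K"
    and abc: "a = pd 1 (pd 1 K) p" "b = pd 1 (pd 2 K) p" "c = pd 2 (pd 2 K) p"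
      "d = pd 1 (pd 3 K) p" "e = pd 2 (pd 3 K) p" "g = pd 3 (pd 3 K) p"
    and T: "T = pd 1 K p" and Kw: "Kw = pd 3 K p" and \<kappa>: "\<kappa> = p $ 2"
  shows "normal_form K p l (\<i> * t) = of_real (sigma K p) ^ 3 *
      det (vector [vector [l * of_real a, l * of_real b, l * of_real d, t * of_real T],
                   vector [- (l * of_real d), t * of_real T - l * of_real e, - (l * of_real g), 0],
                   vector [t * of_real T, l * (of_real T / 2), 0, l * (of_real Kw / 2) - t * of_real \<kappa> * of_real T],
                   vector [l * of_real b, l * of_real c, l * of_real e - t * of_real T, l * (of_real T / 2)]]
           :: complex ^ 4 ^ 4)"
proof -
  have N: "open N" using branch by (simp add: root_branch_def)
  have C1: "C1_on N K" "\<And>i. C1_on N (pd i K)" using reg by (auto simp: regular_on_def)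
  have sym: "pd i (pd j K) p = pd j (pd i K) p" for i j
    using reg p unfolding regular_on_def by blast
  have dK: "(pd i K has_derivative (\<lambda>h. grad (pd i K) p \<bullet> h)) (at p)" for i
    by (rule C1_onD(1)[OF C1(2) N p])
  have pT: "pd i (Tstar K) p = pd i (pd 1 K) p" for i
    by (simp add: Tstar_def[abs_def])
  have p\<eta>: "pd i (eta K) p = - pd i (pd 2 K) p" for i
    unfolding eta_def[abs_def] by (subst pd_eqI[OF has_derivative_minus[OF dK]]) (simp add: inner_axis grad_def)
  have pM: "pd i (mass K) p = - 2 * pd i (pd 3 K) p" for i
    unfolding mass_def[abs_def]
    by (subst pd_eqI[OF has_derivative_mult_right[OF dK]]) (simp add: inner_axis grad_def)
  define K14 where "K14 = pd 1 (pd 4 K) p"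
  define K24 where "K24 = pd 2 (pd 4 K) p"
  \<comment> \<open>\<open>E1\<close> and \<open>E2\<close> turn the entry \<open>d0\<close> into \<open>\<sigma> T\<^sub>*\<^sup>2 \<eta>\<^sub>\<kappa>\<close>.\<close>
  have E1: "p $ 1 * a + \<kappa> / 2 * b + p $ 3 * d + p $ 4 * K14 + T / 2 = 0"
    using euler_identity_derivative[OF F branch p K reg, of 1] by (simp add: abc T \<kappa> K14_def axis_def)
  have E2: "p $ 1 * b + \<kappa> / 2 * c + p $ 3 * e + p $ 4 * K24 = 0"
    using euler_identity_derivative[OF F branch p K reg, of 2] by (simp add: abc T \<kappa> K24_def axis_def sym[of 2 1])
  define s where "s = b * b - a * c"
  define \<gamma> where "\<gamma> = d * c - b * e"
  define r where "r = a * e - d * b"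
  define h where "h = T / 2"
  define w where "w = Kw / 2"
  have Th: "T = 2 * h" and Kww: "Kw = 2 * w" by (simp_all add: h_def w_def)
  have T': "Tstar K p = 2 * h" and M': "mass K p = - 4 * w"
    by (simp_all add: Tstar_def mass_def h_def w_def T Kw)
  have s: "sigma K p = s" and \<gamma>: "gamma_lin K p = \<gamma>" and r: "rho K p = r" 
    and xi: "xi K p = K14 * c - b * K24"
    unfolding sigma_def gamma_lin_def rho_def xi_def bracket_def pT p\<eta> s_def \<gamma>_def r_def abc K14_def K24_def
    by (simp_all add: sym[of 2 1] sym[of 3 1] sym[of 3 2] sym[of 4 1] sym[of 4 2] algebra_simps)
  have \<tau>: "tau K p = h * b" and \<nu>: "nu K p = - (h * a)"
    by (simp_all add: tau_def nu_def T' pT abc sym[of 2 1])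
  \<comment> \<open>The combination \<open>c * E1 - b * E2\<close> eliminates the terms in
    \<kappa>.\<close>
  have "p $ 3 * \<gamma> + p $ 4 * (K14 * c - b * K24) - p $ 1 * s = - (h * c)"
    using E1 E2 unfolding \<gamma>_def s_def h_def[symmetric] by algebra
  then have d0: "p $ 3 * gamma_lin K p + p $ 4 * xi K p - p $ 1 * sigma K p = - (h * c)"
    by (simp add: \<gamma> s xi)
  have n2: "normal2 K p = vector [vector [of_real (s * (\<gamma> * d + r * e + s * g)), of_real (- (s * r * h))],
      vector [of_real (- (s * r * h)), of_real (s * (h * h * a + s * w))]]"
    unfolding normal2_def Let_def s \<gamma> r T' M' \<nu> pM by (simp add: abc sym[of 3 1] sym[of 3 2] algebra_simps)
  have n1: "normal1 K p = vector [vector [\<i> * of_real (4 * s * r * h), \<i> * of_real (s * (2 * h) * (\<gamma> - h * a))],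
      vector [\<i> * of_real (s * (2 * h) * (\<gamma> - h * a)), \<i> * of_real (s * (2 * h) * (2 * h * b + s * \<kappa>))]]"
    unfolding normal1_def Let_def s \<gamma> r T' \<tau> \<nu> \<kappa> by (simp add: algebra_simps)
  have n0: "normal0 K p = vector [vector [of_real (- (4 * s * h * h * a)), of_real (4 * s * h * h * b)],
      vector [of_real (4 * s * h * h * b), of_real (- (4 * s * h * h * c))]]"
    unfolding normal0_def Let_def d0 unfolding s T' \<tau> \<nu> by (simp add: algebra_simps)
  \<comment> \<open>Complex names for the embedded reals let the polynomial identity be applied over
    the complex numbers.\<close>
  define a' b' c' d' e' g' h' w' k' :: complex where
    "a' = of_real a" "b' = of_real b" "c' = of_real c" "d' = of_real d" "e' = of_real e" "g' = of_real g"
    "h' = of_real h" "w' = of_real w" "k' = of_real \<kappa>"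
  define s' where "s' = b' * b' - a' * c'"
  define \<gamma>' where "\<gamma>' = d' * c' - b' * e'"
  define r' where "r' = a' * e' - d' * b'"
  note ofr = a'_b'_c'_d'_e'_g'_h'_w'_k'_def
  have i2: "\<i> * \<i> = -1" by simp
  have "normal_form K p l (\<i> * t) =
      (l\<^sup>2 * (s' * (\<gamma>' * d' + r' * e' + s' * g')) + l * (\<i> * t) * (\<i> * (4 * s' * r' * h'))
         + (\<i> * t)\<^sup>2 * (- (4 * s' * h' * h' * a')))
      * (l\<^sup>2 * (s' * (h' * h' * a' + s' * w')) + l * (\<i> * t) * (\<i> * (s' * (2 * h') * (2 * h' * b' + s' * k')))
         + (\<i> * t)\<^sup>2 * (- (4 * s' * h' * h' * c')))
      - (l\<^sup>2 * (- (s' * r' * h')) + l * (\<i> * t) * (\<i> * (s' * (2 * h') * (\<gamma>' - h' * a')))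
         + (\<i> * t)\<^sup>2 * (4 * s' * h' * h' * b'))\<^sup>2"
    unfolding normal_form_def det_2 n2 n1 n0 s'_def \<gamma>'_def r'_def s_def \<gamma>_def r_def ofr
    by (simp add: power2_eq_square del: mult_minus_right mult_minus_left)
  also have "\<dots> = s'\<^sup>2 * (
     (l\<^sup>2 * (\<gamma>' * d' + r' * e' + s' * g') - l * t * (4 * r' * h') + t\<^sup>2 * (4 * h' * h' * a'))
    * (l\<^sup>2 * (h' * h' * a' + s' * w') - l * t * (2 * h' * (2 * h' * b' + s' * k')) + t\<^sup>2 * (4 * h' * h' * c'))
    - (l\<^sup>2 * (r' * h') + l * t * (2 * h' * (\<gamma>' - h' * a')) + t\<^sup>2 * (4 * h' * h' * b'))\<^sup>2)"
    using i2 by algebra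
  also have "\<dots> = s' ^ 3 * det (vector [vector [l * a', l * b', l * d', t * (2 * h')],
                          vector [- (l * d'), t * (2 * h') - l * e', - (l * g'), 0],
                          vector [t * (2 * h'), l * h', 0, l * w' - t * k' * (2 * h')],
                          vector [l * b', l * c', l * e' - t * (2 * h'), l * h']] :: complex ^ 4 ^ 4)"
    unfolding s'_def \<gamma>'_def r'_def normal_form_identity by (simp add: power2_eq_square power3_eq_cube)
  also have "s' = of_real (sigma K p)"
    unfolding s s_def s'_def ofr by simp
  finally show ?thesis
    unfolding Th Kww ofr by simp
qed

section \<open>Characteristics of the Whitham system\<close>

text \<open>A real covector acting on a complex vector: bilinear, without conjugation.\<close>

definition cdot :: "real ^ 'n \<Rightarrow> complex ^ 'n \<Rightarrow> complex" where
  "cdot G y = (\<Sum>l\<in>UNIV. of_real (G $ l) * y $ l)"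

lemma cdot_linear:
  "cdot (G + G') y = cdot G y + cdot G' y" "cdot (G - G') y = cdot G y - cdot G' y"
  "cdot (c *\<^sub>R G) y = of_real c * cdot G y" "cdot (axis i 1) y = y $ i" "cdot (- G) y = - cdot G y"
proof -
  have "of_real (axis i 1 $ l) * y $ l = (if l = i then y $ l else 0)" for l
    by (simp add: axis_def)
  then show "cdot (axis i 1) y = y $ i" by (simp add: cdot_def)
qed (simp_all add: cdot_def algebra_simps sum.distrib sum_subtractf sum_distrib_left sum_negf)

text \<open>For a linear \<open>A\<close> this is its complex-linear extension, given by the matrix
  with columns \<open>A (axis j 1)\<close>. It is required because the characteristic directions may
  be complex.\<close>

definition complexify :: "(real ^ 'm \<Rightarrow> real ^ 'n) \<Rightarrow> complex ^ 'm \<Rightarrow> complex ^ 'n" where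
  "complexify A x = (\<chi> l. \<Sum>j\<in>UNIV. of_real (A (axis j 1) $ l) * x $ j)"

lemma cdot_complexify: "cdot G (complexify A x) = (\<Sum>j\<in>UNIV. of_real (G \<bullet> A (axis j 1)) * x $ j)"
proof -
  have "cdot G (complexify A x)
      = (\<Sum>l\<in>UNIV. \<Sum>j\<in>UNIV. of_real (G $ l * A (axis j 1) $ l) * x $ j)"
    by (simp add: cdot_def complexify_def sum_distrib_left mult.assoc)
  also have "\<dots> = (\<Sum>j\<in>UNIV. \<Sum>l\<in>UNIV. of_real (G $ l * A (axis j 1) $ l) * x $ j)"
    by (rule sum.swap)
  finally show ?thesis by (simp add: inner_vec_def sum_distrib_right)
qed

lemma restr_pd_eq:
  assumes "(L has_derivative L') (at v)" "(Q has_derivative (\<lambda>h. G \<bullet> h)) (at (L v))"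
  shows "restr_pd L v Q j = G \<bullet> L' (axis j 1)"
  unfolding restr_pd_def comp_def by (rule pd_eqI) (rule has_derivative_compose[OF assms])

text \<open>A kernel vector \<open>x\<close> is a variation of \<open>v\<close>. By the chain rule
  the rows depend on \<open>x\<close> only through the tangent vector
  \<open>complexify L' x\<close>, and the factor \<open>m\<close> cancels.\<close>

lemma char_det_kernel:
  assumes L: "(L has_derivative L') (at v)" "L v = q" and m: "m \<noteq> 0"
    and grads: "(W has_derivative (\<lambda>h. GW \<bullet> h)) (at q)" "(pd 1 W has_derivative (\<lambda>h. GH \<bullet> h)) (at q)"
      "(pd 2 W has_derivative (\<lambda>h. GU \<bullet> h)) (at q)" "(pd 4 W has_derivative (\<lambda>h. GM \<bullet> h)) (at q)"
    and vals: "U = q $ 2" "WH = pd 1 W q" "WU = pd 2 W q" "M = pd 4 W q"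
  shows "char_det (whitham_A W L m v) (whitham_a W L m v) X t = 0 \<longleftrightarrow>
    (\<exists>x. x \<noteq> 0 \<and> (let y = complexify L' x in
        X * y $ 5 - t * y $ 4 = 0
      \<and> X * cdot GH y - t * (of_real U * cdot GH y - of_real WH * y $ 2) = 0
      \<and> X * cdot GU y - t * (of_real U * cdot GU y + of_real WU * y $ 2 - cdot GW y) = 0
      \<and> X * (of_real WH * cdot GM y - of_real M * cdot GH y)
          - t * (of_real U * of_real WH * cdot GM y - of_real U * of_real M * cdot GH y
                 + of_real WH * of_real M * y $ 2 - (of_real WH)\<^sup>2 * y $ 3) = 0))"
proof -
  have coord: "restr_pd L v (\<lambda>q. q $ i) j = axis i 1 \<bullet> L' (axis j 1)" for i j
    by (rule restr_pd_eq[OF L(1)]) (auto intro!: derivative_eq_intros simp: inner_axis')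
  have r: "restr_pd L v W j = GW \<bullet> L' (axis j 1)" "restr_pd L v (pd 1 W) j = GH \<bullet> L' (axis j 1)"
    "restr_pd L v (pd 2 W) j = GU \<bullet> L' (axis j 1)" "restr_pd L v (pd 4 W) j = GM \<bullet> L' (axis j 1)" for j
    by (auto intro!: restr_pd_eq[OF L(1)] simp: L(2) grads)
  have y: "y $ i = cdot (axis i 1) y" for y :: "complex ^ 6" and i
    by (simp add: cdot_linear)
  define m' where "m' = complex_of_real m"
  have m': "m' \<noteq> 0" using m by (simp add: m'_def)
  let ?B = "\<chi> i j. of_real (whitham_A W L m v $ i $ j) * X - of_real (whitham_a W L m v $ i $ j) * t"
  have rows: "(?B *v x = 0) \<longleftrightarrow> (let y = complexify L' x in
        X * y $ 5 - t * y $ 4 = 0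
      \<and> m' * (X * cdot GH y - t * (of_real U * cdot GH y - of_real WH * y $ 2)) = 0
      \<and> m' * (X * cdot GU y - t * (of_real U * cdot GU y + of_real WU * y $ 2 - cdot GW y)) = 0
      \<and> m' * (X * (of_real WH * cdot GM y - of_real M * cdot GH y)
          - t * (of_real U * of_real WH * cdot GM y - of_real U * of_real M * cdot GH y
                 + of_real WH * of_real M * y $ 2 - (of_real WH)\<^sup>2 * y $ 3)) = 0)" for x
    unfolding Let_def y cdot_complexify vec_eq_iff forall_4 matrix_vector_mult_def
    unfolding whitham_A_def whitham_a_def Let_def coord r L(2) m'_def vals
    by (simp add: sum_4 algebra_simps)
  show ?thesis
    unfolding char_det_def det_eq_0_iff_kernel rows using m' by (simp add: Let_def)
qed

text \<open>On a graph over all coordinates but the \<open>i\<close>-th and \<open>\<zeta>\<close> that solves \<open>W_J = 0\<close>,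
  the complexified tangent vectors are exactly the solutions of the linearised constraint.\<close>

lemma tangent_vectors_iff:
  fixes L' :: "real ^ 'm \<Rightarrow> real ^ 6"
  assumes tan: "\<And>w. G \<bullet> L' w = 0" and nz: "G $ i \<noteq> 0" and "i \<noteq> 6"
    and y6: "\<And>x. complexify L' x $ 6 = 0"
    and inj: "\<And>x. complexify L' x = 0 \<Longrightarrow> x = 0"
    and surj: "\<And>y. \<exists>x. \<forall>l. l \<noteq> i \<and> l \<noteq> 6 \<longrightarrow> complexify L' x $ l = y $ l"
  shows "(\<exists>x. x \<noteq> 0 \<and> P (complexify L' x)) \<longleftrightarrow> (\<exists>y. y \<noteq> 0 \<and> y $ 6 = 0 \<and> cdot G y = 0 \<and> P y)"
proof -
  have tanc: "cdot G (complexify L' x) = 0" for x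
    by (simp add: cdot_complexify tan)
  have zero: "complexify L' 0 = 0" by (simp add: complexify_def vec_eq_iff)
  have "\<exists>x. y = complexify L' x" if y: "y $ 6 = 0" "cdot G y = 0" for y
  proof -
    \<comment> \<open>Once \<open>x\<close> matches \<open>y\<close> off the solved coordinate, the
      difference has only an \<open>i\<close>-th entry; \<open>G\<close> annihilates it and
      \<open>G $ i\<close> is nonzero, so that entry vanishes too.\<close>
    obtain x where x: "\<forall>l. l \<noteq> i \<and> l \<noteq> 6 \<longrightarrow> complexify L' x $ l = y $ l" using surj by blast
    have "(\<Sum>l\<in>UNIV. of_real (G $ l) * (y - complexify L' x) $ l) = 0"
      using y(2) tanc[of x] by (simp add: cdot_def algebra_simps sum_subtractf)
    moreover have "(\<Sum>l\<in>UNIV. of_real (G $ l) * (y - complexify L' x) $ l)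
        = (\<Sum>l\<in>{i}. of_real (G $ l) * (y - complexify L' x) $ l)"
      using x y6 y(1) by (intro sum.mono_neutral_right) auto
    ultimately have "y $ i = complexify L' x $ i" using nz by simp
    then have "y = complexify L' x"
      using x y6[of x] y(1) by (metis vec_eq_iff)
    then show ?thesis by blast
  qed
  then show ?thesis using tanc y6 inj zero by metis
qed

text \<open>The solved coordinate is H for \<open>i = 1\<close> and J for \<open>i = 3\<close>. All
  other coordinates of a tangent vector, apart from that of \<zeta>, are a permutation of the
  entries of \<open>x\<close>, which gives injectivity and surjectivity.\<close>

lemma graph_tangent_vectors_iff:
  fixes g' :: "real ^ 4 \<Rightarrow> real" and G :: "real ^ 6"
  assumes "G $ i \<noteq> 0" "\<And>w. G \<bullet> L' w = 0"
    and "i = 1 \<and> L' = (\<lambda>w. vector [g' w, w $ 3, w $ 1, w $ 2, w $ 4, 0])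
       \<or> i = 3 \<and> L' = (\<lambda>w. vector [w $ 1, w $ 3, g' w, w $ 2, w $ 4, 0])"
  shows "(\<exists>x. x \<noteq> 0 \<and> P (complexify L' x)) \<longleftrightarrow> (\<exists>y. y \<noteq> 0 \<and> y $ 6 = 0 \<and> cdot G y = 0 \<and> P y)"
  using assms(3)
proof (elim disjE conjE)
  assume i: "i = 1" and L': "L' = (\<lambda>w. vector [g' w, w $ 3, w $ 1, w $ 2, w $ 4, 0])"
  have c: "complexify L' x $ 2 = x $ 3" "complexify L' x $ 3 = x $ 1" "complexify L' x $ 4 = x $ 2"
    "complexify L' x $ 5 = x $ 4" "complexify L' x $ 6 = 0" for x
    by (simp_all add: complexify_def L' sum_4 axis_def)
  show ?thesis
  proof (rule tangent_vectors_iff[OF assms(2,1) _ c(5)])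
    show "i \<noteq> 6" using i by simp
    show "x = 0" if "complexify L' x = 0" for x
      using c[of x] unfolding that by (simp add: vec_eq_iff forall_4)
    show "\<exists>x. \<forall>l. l \<noteq> i \<and> l \<noteq> 6 \<longrightarrow> complexify L' x $ l = y $ l" for y
      by (rule exI[of _ "vector [y $ 3, y $ 4, y $ 2, y $ 5]"]) (simp add: forall_6 c i)
  qed
next
  assume i: "i = 3" and L': "L' = (\<lambda>w. vector [w $ 1, w $ 3, g' w, w $ 2, w $ 4, 0])"
  have c: "complexify L' x $ 1 = x $ 1" "complexify L' x $ 2 = x $ 3" "complexify L' x $ 4 = x $ 2"
    "complexify L' x $ 5 = x $ 4" "complexify L' x $ 6 = 0" for x
    by (simp_all add: complexify_def L' sum_4 axis_def)
  show ?thesis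
  proof (rule tangent_vectors_iff[OF assms(2,1) _ c(5)])
    show "i \<noteq> 6" using i by simp
    show "x = 0" if "complexify L' x = 0" for x
      using c[of x] unfolding that by (simp add: vec_eq_iff forall_4)
    show "\<exists>x. \<forall>l. l \<noteq> i \<and> l \<noteq> 6 \<longrightarrow> complexify L' x $ l = y $ l" for y
      by (rule exI[of _ "vector [y $ 1, y $ 4, y $ 2, y $ 5]"]) (simp add: forall_6 c i)
  qed
qed

section \<open>Derivatives of \<open>W\<close> in terms of those of \<open>K\<close>\<close>

definition gradW_H :: "(real ^ 4 \<Rightarrow> real) \<Rightarrow> real ^ 6 \<Rightarrow> real ^ 6" where
  "gradW_H K q = (1 / (4 * pi)) *\<^sub>R lin_grad (grad (pd 1 K) (lin_params q)) q"

text \<open>Product rule for the first derivative \<open>W_U\<close>: the \<open>axis\<close> terms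
  come from its coefficients \<open>q $ 3 / 8\<close> and \<open>q $ 5 + q $ 2 / 2\<close>. The same
  coefficient \<open>q $ 5 + q $ 2 / 2\<close> produces those in \<open>gradW_J\<close>.\<close>

definition gradW_U :: "(real ^ 4 \<Rightarrow> real) \<Rightarrow> real ^ 6 \<Rightarrow> real ^ 6" where
  "gradW_U K q = (1 / pi) *\<^sub>R
     ((q $ 3 / 8) *\<^sub>R lin_grad (grad (pd 1 K) (lin_params q)) q
      + (pd 1 K (lin_params q) / 8) *\<^sub>R axis 3 1
      + (q $ 5 + q $ 2 / 2) *\<^sub>R lin_grad (grad (pd 3 K) (lin_params q)) q
      + pd 3 K (lin_params q) *\<^sub>R (axis 5 1 + (1 / 2) *\<^sub>R axis 2 1))"

definition gradW_J :: "(real ^ 4 \<Rightarrow> real) \<Rightarrow> real ^ 6 \<Rightarrow> real ^ 6" where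
  "gradW_J K q = (1 / (4 * pi)) *\<^sub>R
     ((q $ 5 + q $ 2 / 2) *\<^sub>R lin_grad (grad (pd 1 K) (lin_params q)) q
      + pd 1 K (lin_params q) *\<^sub>R (axis 5 1 + (1 / 2) *\<^sub>R axis 2 1)
      + lin_grad (grad (pd 2 K) (lin_params q)) q)"

definition gradW_M :: "(real ^ 4 \<Rightarrow> real) \<Rightarrow> real ^ 6 \<Rightarrow> real ^ 6" where
  "gradW_M K q = - (1 / pi) *\<^sub>R lin_grad (grad (pd 3 K) (lin_params q)) q"

context
  fixes F K am ap N W S
  assumes N: "open N" and K: "K = action F am ap" and W: "W = whitham_W F am ap"
    and reg: "regular_on N K" and S: "S = lin_params -` N"
begin

lemma C1_K: "C1_on N K" "C1_on N (pd i K)"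
  using reg by (auto simp: regular_on_def)

lemma open_S: "open S"
  unfolding S by (intro open_vimage N continuous_on_lin_params)

lemma W_eq: "W = (\<lambda>q. 1 / pi * K (lin_params q))"
  by (simp add: fun_eq_iff W K whitham_W_eq)

lemma comp_deriv:
  assumes "C1_on N k" "q \<in> S"
  shows "((\<lambda>q. k (lin_params q)) has_derivative (\<lambda>h. lin_grad (grad k (lin_params q)) q \<bullet> h)) (at q)"
  using assms by (intro has_derivative_comp_lin_params C1_onD(1)[OF _ N]) (auto simp: S)

lemma W_deriv:
  assumes "q \<in> S"
  shows "(W has_derivative (\<lambda>h. ((1 / pi) *\<^sub>R lin_grad (grad K (lin_params q)) q) \<bullet> h)) (at q)"
  using has_derivative_mult_right[OF comp_deriv[OF C1_K(1) assms], of "1 / pi"] unfolding W_eq by simp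

lemma pd_W:
  assumes "q \<in> S"
  shows "pd 1 W q = 1 / (4 * pi) * pd 1 K (lin_params q)"
    and "pd 2 W q = 1 / pi * (q $ 3 / 8 * pd 1 K (lin_params q) + (q $ 5 + q $ 2 / 2) * pd 3 K (lin_params q))"
    and "pd 3 W q = 1 / (4 * pi) * ((q $ 5 + q $ 2 / 2) * pd 1 K (lin_params q) + pd 2 K (lin_params q))"
    and "pd 4 W q = - (1 / pi) * pd 3 K (lin_params q)"
    and "pd 5 W q = 1 / pi * (q $ 3 / 4 * pd 1 K (lin_params q) + q $ 2 * pd 3 K (lin_params q))"
  unfolding pd_eq_nthI[OF W_deriv[OF assms]]
  by (simp_all add: lin_grad_nth grad_def field_simps)

text \<open>The formulas in \<open>pd_W\<close> hold on the whole open set \<open>S\<close>, so they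
  can be differentiated once more.\<close>

lemma pd_W_deriv:
  assumes q: "q \<in> S"
  shows "(pd 1 W has_derivative (\<lambda>h. gradW_H K q \<bullet> h)) (at q)"
    and "(pd 2 W has_derivative (\<lambda>h. gradW_U K q \<bullet> h)) (at q)"
    and "(pd 3 W has_derivative (\<lambda>h. gradW_J K q \<bullet> h)) (at q)"
    and "(pd 4 W has_derivative (\<lambda>h. gradW_M K q \<bullet> h)) (at q)"
proof -
  note d = comp_deriv[OF C1_K(2) q]
  note tr = has_derivative_transform_within_open[OF _ open_S q pd_W(1)[symmetric]]
    has_derivative_transform_within_open[OF _ open_S q pd_W(2)[symmetric]]
    has_derivative_transform_within_open[OF _ open_S q pd_W(3)[symmetric]]
    has_derivative_transform_within_open[OF _ open_S q pd_W(4)[symmetric]]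
  show "(pd 1 W has_derivative (\<lambda>h. gradW_H K q \<bullet> h)) (at q)"
    by (rule tr(1)) (auto intro!: derivative_eq_intros d simp: gradW_H_def)
  show "(pd 2 W has_derivative (\<lambda>h. gradW_U K q \<bullet> h)) (at q)"
    by (rule tr(2)) (auto intro!: derivative_eq_intros d
        simp: gradW_U_def inner_add_left inner_axis' fun_eq_iff field_simps)
  show "(pd 3 W has_derivative (\<lambda>h. gradW_J K q \<bullet> h)) (at q)"
    by (rule tr(3)) (auto intro!: derivative_eq_intros d
        simp: gradW_J_def inner_add_left inner_axis' fun_eq_iff field_simps)
  show "(pd 4 W has_derivative (\<lambda>h. gradW_M K q \<bullet> h)) (at q)"
    by (rule tr(4)) (auto intro!: derivative_eq_intros d simp: gradW_M_def)
qed

lemma C1_W_J: "C1_on S (pd 3 W)"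
proof (rule C1_onI[OF open_S pd_W_deriv(3)])
  have c: "continuous_on S (\<lambda>q. k (lin_params q))" if "continuous_on N k" for k :: "real ^ 4 \<Rightarrow> 'b::topological_space"
    by (rule continuous_on_compose2[OF that continuous_on_lin_params]) (auto simp: S)
  show "continuous_on S (gradW_J K)"
    unfolding gradW_J_def[abs_def]
    by (intro continuous_intros continuous_on_lin_grad c C1_onD(2,3)[OF C1_K(2) N]) auto
qed

text \<open>These values express \<sigma> through \<open>W\<close>, and with it the case
  distinction; they also give the symmetry of the mixed derivative in H and J.\<close>

lemma second_pd_W:
  assumes q: "q \<in> S" and p: "p = lin_params q"
  shows "pd 3 (pd 3 W) q = 1 / (16 * pi) * ((q $ 5 + q $ 2 / 2)\<^sup>2 * pd 1 (pd 1 K) p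
      + 2 * (q $ 5 + q $ 2 / 2) * pd 1 (pd 2 K) p + pd 2 (pd 2 K) p)"
    and "pd 3 (pd 1 W) q = 1 / (16 * pi) * ((q $ 5 + q $ 2 / 2) * pd 1 (pd 1 K) p + pd 1 (pd 2 K) p)"
    and "pd 1 (pd 3 W) q = 1 / (16 * pi) * ((q $ 5 + q $ 2 / 2) * pd 1 (pd 1 K) p + pd 1 (pd 2 K) p)"
    and "pd 1 (pd 1 W) q = 1 / (16 * pi) * pd 1 (pd 1 K) p"
proof -
  have sym: "pd 2 (pd 1 K) p = pd 1 (pd 2 K) p"
    using reg q unfolding regular_on_def S p by blast
  show "pd 3 (pd 3 W) q = 1 / (16 * pi) * ((q $ 5 + q $ 2 / 2)\<^sup>2 * pd 1 (pd 1 K) p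
      + 2 * (q $ 5 + q $ 2 / 2) * pd 1 (pd 2 K) p + pd 2 (pd 2 K) p)"
    and "pd 3 (pd 1 W) q = 1 / (16 * pi) * ((q $ 5 + q $ 2 / 2) * pd 1 (pd 1 K) p + pd 1 (pd 2 K) p)"
    and "pd 1 (pd 3 W) q = 1 / (16 * pi) * ((q $ 5 + q $ 2 / 2) * pd 1 (pd 1 K) p + pd 1 (pd 2 K) p)"
    and "pd 1 (pd 1 W) q = 1 / (16 * pi) * pd 1 (pd 1 K) p"
    unfolding pd_eq_nthI[OF pd_W_deriv(1)[OF q]] pd_eq_nthI[OF pd_W_deriv(3)[OF q]]
    by (simp_all add: gradW_H_def gradW_J_def lin_grad_nth grad_def axis_def p[symmetric] sym
        power2_eq_square field_simps)
qed

lemma sigma_eq: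
  assumes q: "q \<in> S" and p: "p = lin_params q"
  shows "sigma K p = (pd 1 (pd 2 K) p)\<^sup>2 - pd 1 (pd 1 K) p * pd 2 (pd 2 K) p"
proof -
  have pN: "p \<in> N" using q by (simp add: S p)
  have sym: "pd 2 (pd 1 K) p = pd 1 (pd 2 K) p"
    using reg pN unfolding regular_on_def by blast
  have "pd i (eta K) p = - pd i (pd 2 K) p" for i
    unfolding eta_def[abs_def]
    by (subst pd_eqI[OF has_derivative_minus[OF C1_onD(1)[OF C1_K(2) N pN]]]) (simp add: inner_axis grad_def)
  then show ?thesis
    unfolding sigma_def bracket_def Tstar_def[abs_def] by (simp add: sym power2_eq_square)
qed

section \<open>From the characteristic determinant to the normal form\<close>

lemma characteristic_iff:
  assumes F: "\<And>x. x > 0 \<Longrightarrow> (F has_real_derivative f x) (at x)"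
    and branch: "root_branch F N am ap"
    and q: "q \<in> S" and p: "p = lin_params q" and WJ0: "pd 3 W q = 0"
    and sig: "sigma K p \<noteq> 0" and T: "Tstar K p \<noteq> 0"
    and g: "(g has_derivative g') (at v)" "open V" "v \<in> V" "\<And>v. v \<in> V \<Longrightarrow> pd 3 W (L v) = 0"
    and L: "L v = q" "(L has_derivative L') (at v)"
    and m: "m \<noteq> 0" "pd i (pd 3 W) q \<noteq> 0"
    and i: "i = 1 \<and> L' = (\<lambda>w. vector [g' w, w $ 3, w $ 1, w $ 2, w $ 4, 0])
       \<or> i = 3 \<and> L' = (\<lambda>w. vector [w $ 1, w $ 3, g' w, w $ 2, w $ 4, 0])"
  shows "char_det (whitham_A W L m v) (whitham_a W L m v) X t = 0
     \<longleftrightarrow> normal_form K p (X - of_real (q $ 2) * t) (\<i> * t) = 0"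
proof -
  have pN: "p \<in> N" using q by (simp add: S p)
  have sym: "pd i (pd j K) p = pd j (pd i K) p" for i j
    using reg pN unfolding regular_on_def by blast
  \<comment> \<open>The constraint holds identically along the graph near \<open>v\<close>, so the
    derivative of \<open>W_J\<close> along every tangent vector is zero.\<close>
  have WJL: "((\<lambda>v. pd 3 W (L v)) has_derivative (\<lambda>w. gradW_J K q \<bullet> L' w)) (at v)"
    using has_derivative_compose[OF L(2), of "pd 3 W"] pd_W_deriv(3)[OF q] L(1) by simp
  have "((\<lambda>v. pd 3 W (L v)) has_derivative (\<lambda>w. 0)) (at v)"
    by (rule has_derivative_transform_within_open[OF has_derivative_const g(2,3)]) (simp add: g(4))
  from fun_cong[OF has_derivative_unique[OF WJL this]]
  have tan: "gradW_J K q \<bullet> L' w = 0" for w .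
  have nzJ: "gradW_J K q $ i \<noteq> 0"
    using m(2) pd_eq_nthI[OF pd_W_deriv(3)[OF q]] by simp
  define l where "l = X - of_real (q $ 2) * t"
  define \<kappa> :: complex where "\<kappa> = of_real (p $ 2)"
  have \<kappa>3: "of_real (q $ 3) = 4 * \<kappa>" by (simp add: \<kappa>_def p lin_params_def)
  \<comment> \<open>The forms \<open>ee\<close>, \<open>kk\<close>, \<open>ww\<close> are the
    complexified differentials of E, \<kappa>, \<omega> at \<open>q\<close>, with J written as
    \<open>4 * \<kappa>\<close>.\<close>
  define ee where "ee y = (y$1 + of_real (q $ 5) * y$3 + 4 * \<kappa> * y$5 + of_real (q $ 2) * y$3 / 2 + 2 * \<kappa> * y$2) / 4"
    for y :: "complex ^ 6"
  define kk where "kk y = y$3 / 4" for y :: "complex ^ 6"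
  define ww where "ww y = of_real (q $ 5) * y$2 + of_real (q $ 2) * y$5 + of_real (q $ 2) * y$2 / 2 - y$4"
    for y :: "complex ^ 6"
  have lg: "cdot (lin_grad G q) y = of_real (G $ 1) * ee y + of_real (G $ 2) * kk y + of_real (G $ 3) * ww y"
    if "y $ 6 = 0" for G y
    unfolding lin_grad_def cdot_linear ee_def kk_def ww_def using that
    by (simp add: \<kappa>3 field_simps)
  let ?K = "\<lambda>i j. complex_of_real (pd i (pd j K) p)"
  let ?Tc = "complex_of_real (pd 1 K p)" and ?Kw = "complex_of_real (pd 3 K p)"
  let ?pi = "complex_of_real pi"
  define dT where "dT y = ?K 1 1 * ee y + ?K 1 2 * kk y + ?K 1 3 * ww y" for y
  define dKk where "dKk y = ?K 1 2 * ee y + ?K 2 2 * kk y + ?K 2 3 * ww y" for y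
  define dKw where "dKw y = ?K 1 3 * ee y + ?K 2 3 * kk y + ?K 3 3 * ww y" for y
  have lgs: "cdot (lin_grad (grad (pd 1 K) p) q) y = dT y" "cdot (lin_grad (grad (pd 2 K) p) q) y = dKk y"
    "cdot (lin_grad (grad (pd 3 K) p) q) y = dKw y" if "y $ 6 = 0" for y
    unfolding lg[OF that] dT_def dKk_def dKw_def grad_def by (simp_all add: sym[of 2 1] sym[of 3 1] sym[of 3 2])
  have Tnz: "?Tc \<noteq> 0" using T by (simp add: Tstar_def)
  have WJ0': "pd 2 K p = - (q $ 5 + q $ 2 / 2) * pd 1 K p"
    using WJ0 unfolding pd_W(3)[OF q] p[symmetric] by (simp add: field_simps)
  have pinz: "?pi \<noteq> 0" by simp
  have "char_det (whitham_A W L m v) (whitham_a W L m v) X t = 0 \<longleftrightarrow>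
     (\<exists>y. y \<noteq> 0 \<and> y $ 6 = 0 \<and> cdot (gradW_J K q) y = 0 \<and>
        X * y $ 5 - t * y $ 4 = 0
      \<and> X * cdot (gradW_H K q) y - t * (of_real (q $ 2) * cdot (gradW_H K q) y - of_real (pd 1 W q) * y $ 2) = 0
      \<and> X * cdot (gradW_U K q) y - t * (of_real (q $ 2) * cdot (gradW_U K q) y + of_real (pd 2 W q) * y $ 2
           - cdot ((1 / pi) *\<^sub>R lin_grad (grad K p) q) y) = 0
      \<and> X * (of_real (pd 1 W q) * cdot (gradW_M K q) y - of_real (pd 4 W q) * cdot (gradW_H K q) y)
          - t * (of_real (q $ 2) * of_real (pd 1 W q) * cdot (gradW_M K q) y
                 - of_real (q $ 2) * of_real (pd 4 W q) * cdot (gradW_H K q) y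
                 + of_real (pd 1 W q) * of_real (pd 4 W q) * y $ 2 - (of_real (pd 1 W q))\<^sup>2 * y $ 3) = 0)"
    unfolding char_det_kernel[OF L(2,1) m(1) W_deriv[OF q] pd_W_deriv(1,2,4)[OF q] refl refl refl refl]
      p[symmetric] Let_def
    by (rule graph_tangent_vectors_iff[OF nzJ tan i])
  also have "\<dots> \<longleftrightarrow> det (vector [vector [l * ?K 1 1, l * ?K 1 2, l * ?K 1 3, t * ?Tc],
                   vector [- (l * ?K 1 3), t * ?Tc - l * ?K 2 3, - (l * ?K 3 3), 0],
                   vector [t * ?Tc, l * (?Tc / 2), 0, l * (?Kw / 2) - t * \<kappa> * ?Tc],
                   vector [l * ?K 1 2, l * ?K 2 2, l * ?K 2 3 - t * ?Tc, l * (?Tc / 2)]] :: complex ^ 4 ^ 4) = 0"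
  proof (rule characteristic_kernel[OF pinz Tnz _ ee_def kk_def ww_def dT_def dKk_def dKw_def])
    show "X = l + of_real (q $ 2) * t" by (simp add: l_def)
    show "4 * ?pi * of_real (pd 1 W q) = ?Tc"
      unfolding pd_W(1)[OF q] p[symmetric] by simp
    show "?pi * of_real (pd 4 W q) = - ?Kw"
      unfolding pd_W(4)[OF q] p[symmetric] by simp
    show "?pi * of_real (pd 2 W q) = ?Tc * \<kappa> / 2 + ?Kw * (of_real (q $ 5) + of_real (q $ 2) / 2)"
      unfolding pd_W(2)[OF q] p[symmetric] by (simp add: \<kappa>3 field_simps)
    show "?pi * of_real (pd 5 W q) = ?Tc * \<kappa> + ?Kw * of_real (q $ 2)"
      unfolding pd_W(5)[OF q] p[symmetric] by (simp add: \<kappa>3 field_simps)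
    fix y :: "complex ^ 6" assume y: "y $ 6 = 0"
    note lgs = lgs[OF y]
    have WJc: "cdot ((1 / pi) *\<^sub>R lin_grad (grad K p) q) y
       = (\<Sum>i\<in>UNIV. of_real (pd i W q) * y $ i)"
      using pd_eq_nthI[OF W_deriv[OF q]] unfolding p[symmetric] cdot_def by simp
    \<comment> \<open>The term of \<open>y $ 3\<close> is missing because \<open>W_J = 0\<close> at
      \<open>q\<close>.\<close>
    show "cdot ((1 / pi) *\<^sub>R lin_grad (grad K p) q) y
        = of_real (pd 1 W q) * y $ 1 + of_real (pd 2 W q) * y $ 2 + of_real (pd 4 W q) * y $ 4
          + of_real (pd 5 W q) * y $ 5"
      unfolding WJc sum_6 by (simp add: WJ0 y)
    show "4 * ?pi * cdot (gradW_H K q) y = dT y"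
      unfolding gradW_H_def cdot_linear p[symmetric] lgs by simp
    show "?pi * cdot (gradW_M K q) y = - dKw y"
      unfolding gradW_M_def cdot_linear p[symmetric] lgs by simp
    show "?pi * cdot (gradW_U K q) y = (dT y * \<kappa> + ?Tc * kk y) / 2
        + dKw y * (of_real (q $ 5) + of_real (q $ 2) / 2) + ?Kw * (y $ 5 + y $ 2 / 2)"
      unfolding gradW_U_def cdot_linear p[symmetric] lgs by (simp add: \<kappa>3 kk_def field_simps)
    show "4 * ?pi * cdot (gradW_J K q) y = dT y * (of_real (q $ 5) + of_real (q $ 2) / 2)
        + ?Tc * (y $ 5 + y $ 2 / 2) + dKk y"
      unfolding gradW_J_def cdot_linear p[symmetric] lgs by (simp add: field_simps)
  qed
  also have "\<dots> \<longleftrightarrow> normal_form K p l (\<i> * t) = 0"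
    (is "det ?A = 0 \<longleftrightarrow> _")
  proof -
    have "normal_form K p l (\<i> * t) = of_real (sigma K p) ^ 3 * det ?A"
      unfolding \<kappa>_def by (rule normal_form_eq_det[OF F branch pN K reg refl refl refl refl refl refl refl refl refl])
    then show ?thesis using sig by simp
  qed
  finally show ?thesis by (simp add: l_def)
qed

end



section \<open>Equivalence of characteristics and normal form in both parametrisations\<close>

theorem theorem3:
  fixes f F :: "real \<Rightarrow> real"
    and N :: "(real ^ 4) set"
    and am ap :: "real ^ 4 \<Rightarrow> real"
    and K :: "real ^ 4 \<Rightarrow> real"
    and W :: "real ^ 6 \<Rightarrow> real"
    and H U J \<gamma> \<beta> \<zeta> :: real
    and q :: "real ^ 6"
    and p :: "real ^ 4"
    and Amp :: "real \<Rightarrow> real"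
  assumes antiderivative: "\<And>x. x > 0 \<Longrightarrow> (F has_real_derivative f x) (at x)"
    and branch: "root_branch F N am ap"
    and K: "K = action F am ap"
    and W: "W = whitham_W F am ap"
    and regular: "regular_on N K"
    and q: "q = vector [H, U, J, \<gamma>, \<beta>, \<zeta>]"
    and p: "p = lin_params q"
    and W_J: "pd jJ W q = 0"
    and p_Omega: "p \<in> Omega F"
    and p_N: "p \<in> N"
    and F_indep: "lin_indep_from_1_x_inv F"
    and Amp: "profile F am ap p Amp"
    and Amp_nonconst: "\<not> Amp constant_on UNIV"
    and sigma: "sigma K p \<noteq> 0"
    and D: "D_det K p \<noteq> 0"
    and T: "Tstar K p \<noteq> 0"
  shows "Tstar K p = 4 * pi * pd jH W q
    \<and> (pd jJ (pd jH W) q \<noteq> 0 \<or> pd jJ (pd jJ W) q \<noteq> 0 \<and> pd jH (pd jH W) q \<noteq> 0)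
    \<and> (pd jJ (pd jH W) q \<noteq> 0 \<longrightarrow>
        (let m = pd jJ (pd jH W) q; v = vector [J, \<gamma>, U, \<beta>] in
          (\<exists>g. implicit_solution W (graph_H \<zeta>) v H g) \<and>
          (\<forall>g. implicit_solution W (graph_H \<zeta>) v H g \<longrightarrow>
            (\<forall>X' T'. char_det (whitham_A W (graph_H \<zeta> g) m v) (whitham_a W (graph_H \<zeta> g) m v) X' T' = 0
               \<longleftrightarrow> normal_form K p (X' - of_real U * T') (\<i> * T') = 0))))
    \<and> (pd jJ (pd jJ W) q \<noteq> 0 \<and> pd jH (pd jH W) q \<noteq> 0 \<longrightarrow>
        (let m = pd jJ (pd jJ W) q; v = vector [H, \<gamma>, U, \<beta>] in
          (\<exists>h. implicit_solution W (graph_J \<zeta>) v J h) \<and>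
          (\<forall>h. implicit_solution W (graph_J \<zeta>) v J h \<longrightarrow>
            (\<forall>X' T'. char_det (whitham_A W (graph_J \<zeta> h) m v) (whitham_a W (graph_J \<zeta> h) m v) X' T' = 0
               \<longleftrightarrow> normal_form K p (X' - of_real U * T') (\<i> * T') = 0))))"
proof -
  define S where "S = lin_params -` N"
  have N: "open N" using branch by (simp add: root_branch_def)
  note ctx = N K W regular S_def
  have qS: "q \<in> S" using p p_N by (simp add: S_def)
  have qn: "q $ 1 = H" "q $ 2 = U" "q $ 3 = J" "q $ 4 = \<gamma>" "q $ 5 = \<beta>" "q $ 6 = \<zeta>"
    by (simp_all add: q)
  note main = characteristic_iff[OF ctx antiderivative branch qS p W_J sigma T, unfolded qn]
  \<comment> \<open>The first case assumes that the J-derivative of \<open>W_H\<close> is nonzero,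
    whereas solving for H requires the H-derivative of \<open>W_J\<close>.\<close>
  have sym: "pd 1 (pd 3 W) q = pd 3 (pd 1 W) q"
    using second_pd_W(2,3)[OF ctx qS p] by simp
  have 1: "Tstar K p = 4 * pi * pd 1 W q"
    using pd_W(1)[OF ctx qS] by (simp add: Tstar_def p)
  \<comment> \<open>Each second derivative of \<open>W\<close> carries a factor
    \<open>1 / (16 * pi)\<close>, and the terms with \<open>\<beta> + U / 2\<close> cancel in the
    discriminant.\<close>
  have s: "sigma K p = 256 * pi\<^sup>2 * ((pd 3 (pd 1 W) q)\<^sup>2 - pd 1 (pd 1 W) q * pd 3 (pd 3 W) q)"
    unfolding second_pd_W[OF ctx qS p] sigma_eq[OF ctx qS p] by (simp add: field_simps power2_eq_square)
  have 2: "pd 3 (pd 1 W) q \<noteq> 0 \<or> pd 3 (pd 3 W) q \<noteq> 0 \<and> pd 1 (pd 1 W) q \<noteq> 0"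
    using s sigma by auto
  have caseI: "(\<exists>g. implicit_solution W (graph_H \<zeta>) v H g) \<and>
      (\<forall>g. implicit_solution W (graph_H \<zeta>) v H g \<longrightarrow>
        (\<forall>X' T'. char_det (whitham_A W (graph_H \<zeta> g) m v) (whitham_a W (graph_H \<zeta> g) m v) X' T' = 0
           \<longleftrightarrow> normal_form K p (X' - of_real U * T') (\<i> * T') = 0))"
    if m: "m = pd 3 (pd 1 W) q" "m \<noteq> 0" and v: "v = vector [J, \<gamma>, U, \<beta>]" for m v
  proof (intro conjI allI impI)
    \<comment> \<open>The graph is split into the solved coordinate along \<open>axis 1 1\<close>, a
      linear embedding of the free parameters, and the constant \<zeta>.\<close>
    have gr: "graph_H \<zeta> g w = vector [0, 0, 0, 0, 0, \<zeta>]
        + (g w *\<^sub>R axis 1 1 + vector [0, w $ 3, w $ 1, w $ 2, w $ 4, 0])" for g w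
      by (simp add: graph_H_def vec_eq_iff forall_6 axis_def)
    have E: "bounded_linear (\<lambda>w. vector [0, w $ 3, w $ 1, w $ 2, w $ 4, 0] :: real ^ 6)"
      unfolding linear_conv_bounded_linear[symmetric]
      by (rule linearI) (simp_all add: vec_eq_iff forall_6)
    have gq: "graph_H \<zeta> g v = q" if "g v = H" for g
      using that by (simp add: graph_H_def v q)
    then have gq0: "graph_H \<zeta> (\<lambda>_. H) v = q" by simp
    show "\<exists>g. implicit_solution W (graph_H \<zeta>) v H g"
      by (rule implicit_solution_exists[where graph = "graph_H \<zeta>" and i = 1
            and E = "\<lambda>w. vector [0, w $ 3, w $ 1, w $ 2, w $ 4, 0]", OF open_S[OF ctx] C1_W_J[OF ctx] gr E])
         (use gq0 qS W_J m sym in simp_all)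
    fix g X' T'
    assume "implicit_solution W (graph_H \<zeta>) v H g"
    then obtain V where g: "g v = H" "open V" "v \<in> V" "C1_on V g"
      "\<And>w. w \<in> V \<Longrightarrow> pd 3 W (graph_H \<zeta> g w) = 0"
      unfolding implicit_solution_def by blast
    note dg = C1_onD(1)[OF g(4,2,3)]
    show "char_det (whitham_A W (graph_H \<zeta> g) m v) (whitham_a W (graph_H \<zeta> g) m v) X' T' = 0
           \<longleftrightarrow> normal_form K p (X' - of_real U * T') (\<i> * T') = 0"
      by (rule main[OF _ dg g(2,3,5) gq[of g, OF g(1)] graph_has_derivative(1)[OF dg] m(2), where i = 1])
         (use m sym in auto)
  qed
  have caseJ: "(\<exists>h. implicit_solution W (graph_J \<zeta>) v J h) \<and>
      (\<forall>h. implicit_solution W (graph_J \<zeta>) v J h \<longrightarrow>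
        (\<forall>X' T'. char_det (whitham_A W (graph_J \<zeta> h) m v) (whitham_a W (graph_J \<zeta> h) m v) X' T' = 0
           \<longleftrightarrow> normal_form K p (X' - of_real U * T') (\<i> * T') = 0))"
    if m: "m = pd 3 (pd 3 W) q" "m \<noteq> 0" and v: "v = vector [H, \<gamma>, U, \<beta>]" for m v
  proof (intro conjI allI impI)
    have gr: "graph_J \<zeta> g w = vector [0, 0, 0, 0, 0, \<zeta>]
        + (g w *\<^sub>R axis 3 1 + vector [w $ 1, w $ 3, 0, w $ 2, w $ 4, 0])" for g w
      by (simp add: graph_J_def vec_eq_iff forall_6 axis_def)
    have E: "bounded_linear (\<lambda>w. vector [w $ 1, w $ 3, 0, w $ 2, w $ 4, 0] :: real ^ 6)"
      unfolding linear_conv_bounded_linear[symmetric]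
      by (rule linearI) (simp_all add: vec_eq_iff forall_6)
    have gq: "graph_J \<zeta> g v = q" if "g v = J" for g
      using that by (simp add: graph_J_def v q)
    then have gq0: "graph_J \<zeta> (\<lambda>_. J) v = q" by simp
    show "\<exists>g. implicit_solution W (graph_J \<zeta>) v J g"
      by (rule implicit_solution_exists[where graph = "graph_J \<zeta>" and i = 3
            and E = "\<lambda>w. vector [w $ 1, w $ 3, 0, w $ 2, w $ 4, 0]", OF open_S[OF ctx] C1_W_J[OF ctx] gr E])
         (use gq0 qS W_J m in simp_all)
    fix g X' T'
    assume "implicit_solution W (graph_J \<zeta>) v J g"
    then obtain V where g: "g v = J" "open V" "v \<in> V" "C1_on V g"
      "\<And>w. w \<in> V \<Longrightarrow> pd 3 W (graph_J \<zeta> g w) = 0"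
      unfolding implicit_solution_def by blast
    note dg = C1_onD(1)[OF g(4,2,3)]
    show "char_det (whitham_A W (graph_J \<zeta> g) m v) (whitham_a W (graph_J \<zeta> g) m v) X' T' = 0
           \<longleftrightarrow> normal_form K p (X' - of_real U * T') (\<i> * T') = 0"
      by (rule main[OF _ dg g(2,3,5) gq[of g, OF g(1)] graph_has_derivative(2)[OF dg] m(2), where i = 3])
         (use m in auto)
  qed
  show ?thesis
    unfolding Let_def using 1 2 caseI[OF refl _ refl] caseJ[OF refl _ refl] by blast
qed

end
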